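(* For every $n\ge2$, the statistics $w\mapsto\mathbf{F}\,w$ and $w\mapsto n-\mathbf{NL}\,w$ on $\mathrm{And}_n^{I}$ are both Entringerian, i.e. for every $m\in\{1,\dots,n\}$, $\#\{w\in\mathrm{And}_n^{I}:\mathbf{F}\,w=m\}=\#\{w\in\mathrm{And}_n^{I}:n-\mathbf{NL}\,w=m\}=E_n(m)$ (and $\#\mathrm{And}_n^I=E_n$). Moreover the joint distribution of $(\mathbf{F},\,n-\mathbf{NL})$ on $\mathrm{And}_n^{I}$ is symmetric: for all integers $p,q$, $\#\{w:(\mathbf{F}\,w,n-\mathbf{NL}\,w)=(p,q)\}=\#\{w:(\mathbf{F}\,w,n-\mathbf{NL}\,w)=(q,p)\}$.
   Context: Andr\'e I permutations: words are permutations of finite sets $Y$ of positive integers; the empty word and one-letter words are Andr\'e I; for $|Y|\ge2$ write $w=v\,\min(w)\,v'$; $w$ is Andr\'e I if $v,v'$ are Andr\'e I and $\max(vv')$ is a letter of $v'$. $\mathrm{And}_n^{I}$: Andr\'e I permutations of $\{1,\dots,n\}$. For $w=x_1\cdots x_n$: $\mathbf{F}\,w=x_1$, $\mathbf{NL}\,w=x_{n-1}$. $E_n$: $\sum_{n\ge0}E_nu^n/n!=\tan u+\sec u$. Entringer numbers $E_n(m)$ ($1\le m\le n$): $E_1(1)=1$, $E_n(n)=0$ for $n\ge2$, $E_n(m+1)-E_n(m)+E_{n-1}(n-m)=0$ for $n\ge2$, $1\le m\le n-1$. *)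

theory Defs
  imports
    "HOL-Combinatorics.Multiset_Permutations"
    "HOL-Computational_Algebra.Formal_Power_Series"
begin

inductive andre_I :: "nat list \<Rightarrow> bool" where
  Nil: "andre_I []"
| singleton: "0 < x \<Longrightarrow> andre_I [x]"
| split: "\<lbrakk>v @ v' \<noteq> []; 0 < x; distinct (v @ x # v'); x = Min (set (v @ x # v'));
    andre_I v; andre_I v'; Max (set (v @ v')) \<in> set v'\<rbrakk> \<Longrightarrow> andre_I (v @ x # v')"

definition And_I :: "nat \<Rightarrow> nat list set" where
  "And_I n = {w \<in> permutations_of_set {1..n}. andre_I w}"

definition first_letter :: "nat list \<Rightarrow> nat" where
  "first_letter w = hd w"

(* x_{n-1} in the word x_1 ... x_n; meaningful for words of length at least 2 *)
definition next_to_last :: "nat list \<Rightarrow> nat" where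
  "next_to_last w = w ! (length w - 2)"

definition euler_number :: "nat \<Rightarrow> real" where
  "euler_number n = fact n * fps_nth (fps_tan 1 + inverse (fps_cos 1)) n"

(* Meaningful for 1 \<le> m \<le> n, with junk value 0 outside this range. On it, E_n(m) is obtained by
   downward recursion on m from E_n(n); the lemmas below restate the recurrence. *)
function entringer :: "nat \<Rightarrow> nat \<Rightarrow> nat" where
  "entringer n m =
    (if n = 1 \<and> m = 1 then 1
     else if 1 \<le> m \<and> m < n then entringer n (m + 1) + entringer (n - 1) (n - m)
     else 0)"
  by pat_completeness auto
termination by (relation "measures [\<lambda>(n, m). n, \<lambda>(n, m). n - m]") auto

declare entringer.simps [simp del]

lemma entringer_1_1: "entringer 1 1 = 1"
  by (simp add: entringer.simps)

lemma entringer_diag: "n \<ge> 2 \<Longrightarrow> entringer n n = 0"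
  by (simp add: entringer.simps)

lemma entringer_rec:
  assumes "n \<ge> 2" "1 \<le> m" "m \<le> n - 1"
  shows "int (entringer n (m + 1)) - int (entringer n m) + int (entringer (n - 1) (n - m)) = 0"
  using assms by (simp add: entringer.simps [of n m])

end

theory Submission imports Defs begin

text \<open>
  Cutting a word at its minimum splits the remaining letters over two shorter words, the right one
  containing the maximum. In terms of exponential generating functions with one variable for each
  range of labels (below, between, above the marked letters), this gives differential equations
  with explicit solutions. Let \<open>E = tan + sec\<close> be taken in the sum of all variables, so that
  \<open>E'' = E E'\<close>, and let \<open>x\<close> and \<open>z\<close> be the variables of the labels below and above the marked
  letters. Then words are counted by \<open>E\<close>, words with prescribed first letter by
  \<open>cos z + E sin z\<close>, words with prescribed next-to-last letter by \<open>E' cos z\<close>, and words with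
  prescribed first letter \<open>p\<close> and next-to-last letter \<open>r\<close> by \<open>E' cos x cos z\<close> if \<open>p < r\<close> and by
  \<open>cos x cos z + E sin (x + z) + (E' - 1) sin x sin z\<close> if \<open>r < p\<close>. Both are symmetric in \<open>x\<close> and
  \<open>z\<close>, which is the symmetry of the joint distribution. The Entringer recurrence is the identity
  \<open>(\<partial>\<^sub>z - \<partial>\<^sub>x) (cos z + E sin z) = E cos z - sin z = cos x + E sin x\<close>.
\<close>

section \<open>Set functions under subset convolution\<close>

text \<open>
  Multivariate exponential generating functions, modelled as functions of the finite label set.
  The product distributes the labels over the two factors, so no binomial coefficients occur.
\<close>

typedef 'a sfun = "{f :: 'a set \<Rightarrow> real. \<forall>S. infinite S \<longrightarrow> f S = 0}"
  morphisms sval Abs_sfun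
  by (rule exI [of _ "\<lambda>_. 0"]) simp

setup_lifting type_definition_sfun

lemma sfun_eqI: "(\<And>S. finite S \<Longrightarrow> sval f S = sval g S) \<Longrightarrow> f = g"
  by transfer (metis ext)

definition sconv :: "('a set \<Rightarrow> real) \<Rightarrow> ('a set \<Rightarrow> real) \<Rightarrow> 'a set \<Rightarrow> real" where
  "sconv f g S = (\<Sum>T\<in>Pow S. f T * g (S - T))"

text \<open>For infinite \<open>S\<close> the index set \<open>Pow S\<close> is infinite and the sum
  takes its default value 0. This keeps the product among the functions that vanish on infinite
  sets.\<close>

lemma sconv_infinite: "infinite S \<Longrightarrow> sconv f g S = 0"
  by (simp add: sconv_def)

lemma sconv_commute: "sconv f g S = sconv g f S"
  unfolding sconv_def
  by (rule sum.reindex_bij_witness [of _ "\<lambda>T. S - T" "\<lambda>T. S - T"])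
     (auto simp: double_diff mult.commute)

text \<open>Both sides sum over the ordered splittings of \<open>S\<close> into three disjoint
  pieces.\<close>

lemma sconv_assoc:
  assumes "finite S"
  shows "sconv (sconv f g) h S = sconv f (sconv g h) S"
proof -
  have "sconv (sconv f g) h S = (\<Sum>T\<in>Pow S. \<Sum>U\<in>Pow T. f U * g (T - U) * h (S - T))"
    by (simp add: sconv_def sum_distrib_right)
  also have "\<dots> = (\<Sum>(T, U)\<in>(SIGMA T:Pow S. Pow T). f U * g (T - U) * h (S - T))"
    using assms by (intro sum.Sigma) (auto intro: finite_subset)
  also have "\<dots> = (\<Sum>(U, V)\<in>(SIGMA U:Pow S. Pow (S - U)). f U * (g V * h (S - U - V)))"
    \<comment> \<open>A pair \<open>(T, U)\<close> stands for the pieces \<open>U\<close>,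
      \<open>T - U\<close>, \<open>S - T\<close>; the reindexing records the first two of
      them.\<close>
    by (rule sum.reindex_bij_witness [of _ "\<lambda>(U, V). (U \<union> V, U)" "\<lambda>(T, U). (U, T - U)"])
       (auto simp: Diff_Int_distrib Un_Diff Diff_triv intro!: arg_cong [of _ _ h] arg_cong [of _ _ g])
  also have "\<dots> = (\<Sum>U\<in>Pow S. \<Sum>V\<in>Pow (S - U). f U * (g V * h (S - U - V)))"
    using assms by (intro sum.Sigma [symmetric]) (auto intro: finite_subset)
  also have "\<dots> = sconv f (sconv g h) S"
    by (simp add: sconv_def sum_distrib_left)
  finally show ?thesis .
qed

lemma sconv_unit: "finite S \<Longrightarrow> sconv (\<lambda>S. if S = {} then c else 0) f S = c * f S"
  by (simp add: sconv_def if_distrib [where f = "\<lambda>x. x * _"] sum.delta cong: if_cong)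

instantiation sfun :: (type) comm_ring_1
begin

lift_definition zero_sfun :: "'a sfun" is "\<lambda>_. 0" by simp
lift_definition one_sfun :: "'a sfun" is "\<lambda>S. if S = {} then 1 else 0" by auto
lift_definition plus_sfun :: "'a sfun \<Rightarrow> 'a sfun \<Rightarrow> 'a sfun" is "\<lambda>f g S. f S + g S" by simp
lift_definition minus_sfun :: "'a sfun \<Rightarrow> 'a sfun \<Rightarrow> 'a sfun" is "\<lambda>f g S. f S - g S" by simp
lift_definition uminus_sfun :: "'a sfun \<Rightarrow> 'a sfun" is "\<lambda>f S. - f S" by simp
lift_definition times_sfun :: "'a sfun \<Rightarrow> 'a sfun \<Rightarrow> 'a sfun" is sconv
  by (simp add: sconv_infinite)

instance
proof
  fix a b c :: "'a sfun"
  show "a * b * c = a * (b * c)"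
  proof (rule sfun_eqI)
    fix S :: "'a set"
    assume "finite S"
    thus "sval (a * b * c) S = sval (a * (b * c)) S"
      by transfer (rule sconv_assoc)
  qed
  show "a * b = b * a"
    by transfer (simp add: fun_eq_iff sconv_commute)
  show "1 * a = a"
  proof (rule sfun_eqI)
    fix S :: "'a set"
    assume "finite S"
    thus "sval (1 * a) S = sval a S"
      by transfer (simp add: sconv_unit)
  qed
  show "(a + b) * c = a * c + b * c"
    by transfer (simp add: fun_eq_iff sconv_def distrib_right sum.distrib)
  show "(0 :: 'a sfun) \<noteq> 1"
    by transfer (metis zero_neq_one)
qed (transfer; simp add: fun_eq_iff)+

end

lemma sval_zero [simp]: "sval 0 S = 0"
  and sval_one: "sval 1 S = (if S = {} then 1 else 0)"
  and sval_add [simp]: "sval (f + g) S = sval f S + sval g S"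
  and sval_diff [simp]: "sval (f - g) S = sval f S - sval g S"
  and sval_uminus [simp]: "sval (- f) S = - sval f S"
  and sval_mult: "sval (f * g) S = (\<Sum>T\<in>Pow S. sval f T * sval g (S - T))"
  by (transfer, simp add: sconv_def)+

lemma sum_Pow_insert:
  fixes f :: "'a set \<Rightarrow> 'b :: comm_monoid_add"
  assumes "finite S" "a \<notin> S"
  shows "sum f (Pow (insert a S)) = (\<Sum>T\<in>Pow S. f T) + (\<Sum>T\<in>Pow S. f (insert a T))"
proof -
  have "inj_on (insert a) (Pow S)"
    using assms(2) by (intro inj_onI) (metis Diff_insert_absorb PowD insert_Diff1 subsetD insert_ident)
  moreover have "Pow S \<inter> insert a ` Pow S = {}"
    using assms(2) by auto
  ultimately show ?thesis
    using assms(1) by (simp add: Pow_insert sum.union_disjoint sum.reindex)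
qed

text \<open>
  Partial derivative with respect to the label \<open>a\<close>. It is a relation because the Leibniz rule
  holds only on sets that do not contain \<open>a\<close>.
\<close>

definition sderiv :: "'a \<Rightarrow> 'a sfun \<Rightarrow> 'a sfun \<Rightarrow> bool" where
  "sderiv a f f' \<longleftrightarrow> (\<forall>S. finite S \<longrightarrow> a \<notin> S \<longrightarrow> sval f (insert a S) = sval f' S)"

lemma sderivD: "sderiv a f f' \<Longrightarrow> finite S \<Longrightarrow> a \<notin> S \<Longrightarrow> sval f (insert a S) = sval f' S"
  by (simp add: sderiv_def)

lemma sderiv_one: "sderiv a 1 0"
  by (simp add: sderiv_def sval_one)

lemma sderiv_add: "sderiv a f f' \<Longrightarrow> sderiv a g g' \<Longrightarrow> sderiv a (f + g) (f' + g')"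
  by (simp add: sderiv_def)

lemma sderiv_diff: "sderiv a f f' \<Longrightarrow> sderiv a g g' \<Longrightarrow> sderiv a (f - g) (f' - g')"
  by (simp add: sderiv_def)

text \<open>The label \<open>a\<close> goes to exactly one of the two factors, so the sum over the
  subsets of \<open>insert a S\<close> splits by membership of \<open>a\<close>.\<close>

lemma sderiv_mult:
  assumes "sderiv a f f'" "sderiv a g g'"
  shows "sderiv a (f * g) (f' * g + f * g')"
  unfolding sderiv_def
proof (intro allI impI)
  fix S :: "'a set"
  assume S: "finite S" "a \<notin> S"
  have 1: "sval f T * sval g (insert a S - T) = sval f T * sval g' (S - T)" if "T \<in> Pow S" for T
  proof -
    from that S have "insert a S - T = insert a (S - T)" "a \<notin> S - T" "finite (S - T)" by auto
    thus ?thesis using sderivD [OF assms(2)] by simp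
  qed
  have 2: "sval f (insert a T) = sval f' T" if "T \<in> Pow S" for T
    using that S by (intro sderivD [OF assms(1)]) (auto intro: finite_subset)
  show "sval (f * g) (insert a S) = sval (f' * g + f * g') S"
    using S by (simp add: sval_mult sum_Pow_insert 1 2)
qed

section \<open>Change of variables\<close>

text \<open>Substitution along \<open>h\<close>. Agreement is demanded on all subsets of
  \<open>S\<close> because a product on \<open>S\<close> involves its factors on subsets. With the
  identity as \<open>h\<close>, it replaces a factor by a simpler one with the same values on
  subsets of \<open>S\<close>.\<close>

definition sagree :: "('a \<Rightarrow> 'b) \<Rightarrow> 'a set \<Rightarrow> 'b sfun \<Rightarrow> 'a sfun \<Rightarrow> bool" where
  "sagree h S f g \<longleftrightarrow> inj_on h S \<and> (\<forall>T\<subseteq>S. sval f (h ` T) = sval g T)"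

lemma sagreeD: "sagree h S f g \<Longrightarrow> sval f (h ` S) = sval g S"
  by (simp add: sagree_def)

lemma sagree_one: "inj_on h S \<Longrightarrow> sagree h S 1 1"
  by (simp add: sagree_def sval_one)

lemma sagree_add: "sagree h S f f' \<Longrightarrow> sagree h S g g' \<Longrightarrow> sagree h S (f + g) (f' + g')"
  by (simp add: sagree_def)

lemma sagree_diff: "sagree h S f f' \<Longrightarrow> sagree h S g g' \<Longrightarrow> sagree h S (f - g) (f' - g')"
  by (simp add: sagree_def)

lemma sagree_mult:
  assumes "sagree h S f f'" "sagree h S g g'"
  shows "sagree h S (f * g) (f' * g')"
  unfolding sagree_def
proof (intro conjI allI impI)
  show inj: "inj_on h S" using assms by (simp add: sagree_def)
  fix T
  assume T: "T \<subseteq> S"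
  hence injT: "inj_on h T" using inj inj_on_subset by blast
  have "sval (f * g) (h ` T) = (\<Sum>U\<in>Pow T. sval f (h ` U) * sval g (h ` T - h ` U))"
    unfolding sval_mult
    by (subst image_Pow_surj [OF refl, symmetric], subst sum.reindex)
       (simp_all add: inj_on_image_Pow [OF injT] )
  also have "\<dots> = (\<Sum>U\<in>Pow T. sval f' U * sval g' (T - U))"
  proof (intro sum.cong refl)
    fix U
    assume U: "U \<in> Pow T"
    hence "h ` T - h ` U = h ` (T - U)"
      using inj_on_image_set_diff [OF injT, of T U] by auto
    moreover have "U \<subseteq> S" "T - U \<subseteq> S" using U T by auto
    ultimately show "sval f (h ` U) * sval g (h ` T - h ` U) = sval f' U * sval g' (T - U)"
      using assms by (simp add: sagree_def)
  qed
  finally show "sval (f * g) (h ` T) = sval (f' * g') T"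
    by (simp add: sval_mult)
qed

section \<open>Exponential generating functions on a set of labels\<close>

text \<open>The power series \<open>A\<close> evaluated at the sum of the variables labelled by
  \<open>X\<close>, reduced to its squarefree coefficients, which are the derivatives of
  \<open>A\<close> at 0.\<close>

lift_definition egf :: "real fps \<Rightarrow> 'a set \<Rightarrow> 'a sfun" is
  "\<lambda>A X S. if finite S \<and> S \<subseteq> X then fact (card S) * fps_nth A (card S) else 0"
  by simp

lemma sval_egf:
  "sval (egf A X) S = (if finite S \<and> S \<subseteq> X then fact (card S) * fps_nth A (card S) else 0)"
  by transfer simp

lemma egf_one [simp]: "egf 1 X = 1"
  by (rule sfun_eqI) (auto simp: sval_egf sval_one)

lemma egf_add: "egf (A + B) X = egf A X + egf B X"
  and egf_diff: "egf (A - B) X = egf A X - egf B X"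
  and egf_uminus: "egf (- A) X = - egf A X"
  by (rule sfun_eqI; simp add: sval_egf algebra_simps)+

lemma sum_Pow_card:
  fixes h :: "nat \<Rightarrow> real"
  assumes "finite S"
  shows "(\<Sum>T\<in>Pow S. h (card T)) = (\<Sum>k\<le>card S. real (card S choose k) * h k)"
proof -
  have "(\<Sum>T\<in>Pow S. h (card T)) = (\<Sum>k\<le>card S. \<Sum>T\<in>{T \<in> Pow S. card T = k}. h (card T))"
    using assms by (intro sum.group [symmetric]) (auto intro: card_mono)
  also have "\<dots> = (\<Sum>k\<le>card S. real (card S choose k) * h k)"
    by (intro sum.cong refl) (use n_subsets [OF assms] in simp)
  finally show ?thesis .
qed

text \<open>Grouping subsets by size turns subset convolution into binomial convolution, and the
  factorials absorb the binomial coefficients.\<close>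

lemma egf_mult: "egf (A * B) X = egf A X * egf B X"
proof (rule sfun_eqI)
  fix S :: "'a set"
  assume fin: "finite S"
  show "sval (egf (A * B) X) S = sval (egf A X * egf B X) S"
  proof (cases "S \<subseteq> X")
    case True
    let ?n = "card S"
    let ?h = "\<lambda>k. fact k * fps_nth A k * (fact (?n - k) * fps_nth B (?n - k))"
    have "sval (egf A X * egf B X) S = (\<Sum>T\<in>Pow S. ?h (card T))"
      unfolding sval_mult
    proof (intro sum.cong refl)
      fix T
      assume "T \<in> Pow S"
      thus "sval (egf A X) T * sval (egf B X) (S - T) = ?h (card T)"
        using True fin by (auto simp: sval_egf card_Diff_subset finite_subset)
    qed
    also have "\<dots> = (\<Sum>k\<le>?n. real (?n choose k) * ?h k)"
      by (rule sum_Pow_card [OF fin])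
    also have "\<dots> = (\<Sum>k\<le>?n. fact ?n * (fps_nth A k * fps_nth B (?n - k)))"
      by (intro sum.cong refl) (simp add: binomial_fact)
    also have "\<dots> = sval (egf (A * B) X) S"
      using True fin by (simp add: sval_egf fps_mult_nth sum_distrib_left atLeast0AtMost)
    finally show ?thesis ..
  next
    case False
    \<comment> \<open>An element of \<open>S\<close> outside \<open>X\<close> lies in
      \<open>T\<close> or in \<open>S - T\<close>, so one factor vanishes.\<close>
    hence "sval (egf A X) T * sval (egf B X) (S - T) = 0" for T
      by (auto simp: sval_egf)
    hence "sval (egf A X * egf B X) S = 0" unfolding sval_mult by (intro sum.neutral ballI)
    thus ?thesis using False by (simp add: sval_egf)
  qed
qed

lemma sderiv_egf_in: "a \<in> X \<Longrightarrow> sderiv a (egf A X) (egf (fps_deriv A) X)"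
  by (auto simp: sderiv_def sval_egf)

lemma sderiv_egf_notin: "a \<notin> X \<Longrightarrow> sderiv a (egf A X) 0"
  by (auto simp: sderiv_def sval_egf)

lemma sagree_egf:
  assumes "inj_on h S" "\<And>x. x \<in> S \<Longrightarrow> h x \<in> X \<longleftrightarrow> x \<in> X'"
  shows "sagree h S (egf A X) (egf A X')"
  unfolding sagree_def
proof (intro conjI allI impI)
  fix T
  assume T: "T \<subseteq> S"
  hence "inj_on h T" using assms(1) inj_on_subset by blast
  thus "sval (egf A X) (h ` T) = sval (egf A X') T"
    using T assms(2) by (auto simp: sval_egf card_image finite_image_iff)
qed fact

text \<open>On labels outside \<open>X\<close> only the empty set contributes, so the function
  collapses to its constant term: sines become 0 and cosines 1.\<close>

lemma sagree_egf_disjoint: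
  assumes "S \<inter> X = {}"
  shows "fps_nth A 0 = 0 \<Longrightarrow> sagree (\<lambda>x. x) S (egf A X) 0"
    and "fps_nth A 0 = 1 \<Longrightarrow> sagree (\<lambda>x. x) S (egf A X) 1"
proof -
  have "sval (egf A X) T = (if T = {} then fps_nth A 0 else 0)" if "T \<subseteq> S" for T
    using that assms by (cases "T = {}") (auto simp: sval_egf)
  thus "fps_nth A 0 = 0 \<Longrightarrow> sagree (\<lambda>x. x) S (egf A X) 0"
    "fps_nth A 0 = 1 \<Longrightarrow> sagree (\<lambda>x. x) S (egf A X) 1"
    by (auto simp: sagree_def sval_one)
qed

section \<open>Tangent, secant and trigonometric identities\<close>

definition fps_tan_sec :: "real fps" where
  "fps_tan_sec = fps_tan 1 + inverse (fps_cos 1)"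

lemma fps_cos_nonzero: "fps_cos (c :: real) \<noteq> 0"
  by (metis fps_cos_nth_0 fps_zero_nth zero_neq_one)

lemma fps_sin_deriv_1: "fps_deriv (fps_sin (1 :: real)) = fps_cos 1"
  by (simp add: fps_sin_deriv)

lemma fps_cos_deriv_1: "fps_deriv (fps_cos (1 :: real)) = - fps_sin 1"
proof -
  have "fps_const (- 1 :: real) = - 1" by (metis fps_const_1_eq_1 fps_const_neg)
  thus ?thesis by (simp add: fps_cos_deriv)
qed

lemma tan_sec_mult_cos: "fps_tan_sec * fps_cos 1 = 1 + fps_sin 1"
proof -
  have u: "fps_cos (1 :: real) dvd 1" by (simp add: fps_is_unit_iff)
  have "fps_tan 1 * fps_cos 1 = (fps_sin 1 :: real fps)"
    using u unfolding fps_tan_def by (metis dvd_div_mult_self dvd_trans one_dvd)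
  moreover have "inverse (fps_cos 1) * fps_cos 1 = (1 :: real fps)"
    by (intro inverse_mult_eq_1) simp
  ultimately show ?thesis by (simp add: fps_tan_sec_def distrib_right add.commute)
qed

lemma sin_cos_squares: "fps_sin (1 :: real) * fps_sin 1 = 1 - fps_cos 1 * fps_cos 1"
  using fps_sin_cos_sum_of_squares [of "1 :: real"] by (simp add: power2_eq_square algebra_simps)

text \<open>After multiplication by the cosine, which can be cancelled,
  \<open>tan_sec_mult_cos\<close> makes both sides polynomials in sine and cosine.\<close>

lemma tan_sec_mult_sin: "fps_tan_sec * fps_sin 1 = fps_tan_sec - fps_cos 1"
proof -
  have "(fps_tan_sec * fps_sin 1) * fps_cos 1 = (fps_tan_sec - fps_cos 1) * fps_cos 1"
    using tan_sec_mult_cos sin_cos_squares by algebra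
  thus ?thesis using fps_cos_nonzero mult_right_cancel by blast
qed

text \<open>The derivative of \<open>tan_sec_mult_cos\<close>, with the sine term replaced by
  \<open>tan_sec_mult_sin\<close>.\<close>

lemma deriv_tan_sec_mult_cos: "fps_deriv fps_tan_sec * fps_cos 1 = fps_tan_sec"
proof -
  have "fps_deriv (fps_tan_sec * fps_cos 1) = fps_deriv (1 + fps_sin 1)"
    by (simp only: tan_sec_mult_cos)
  hence "fps_deriv fps_tan_sec * fps_cos 1 - fps_tan_sec * fps_sin 1 = fps_cos 1"
    by (simp add: fps_sin_deriv_1 fps_cos_deriv_1)
  thus ?thesis by (simp add: tan_sec_mult_sin)
qed

lemma deriv_tan_sec_mult_sin: "fps_deriv fps_tan_sec * fps_sin 1 = fps_deriv fps_tan_sec - 1"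
proof -
  have "(fps_deriv fps_tan_sec * fps_sin 1) * fps_cos 1 = (fps_deriv fps_tan_sec - 1) * fps_cos 1"
  proof -
    have "(fps_deriv fps_tan_sec * fps_sin 1) * fps_cos 1
        = (fps_deriv fps_tan_sec * fps_cos 1) * fps_sin 1"
      by (simp only: mult_ac)
    thus ?thesis by (simp add: left_diff_distrib deriv_tan_sec_mult_cos tan_sec_mult_sin)
  qed
  thus ?thesis using fps_cos_nonzero mult_right_cancel by blast
qed

lemma tan_sec_square: "fps_tan_sec * fps_tan_sec = 2 * fps_deriv fps_tan_sec - 1"
proof -
  have "(fps_tan_sec * fps_tan_sec) * fps_cos 1 = (2 * fps_deriv fps_tan_sec - 1) * fps_cos 1"
    by (simp add: mult.assoc left_diff_distrib deriv_tan_sec_mult_cos tan_sec_mult_cos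
        distrib_left tan_sec_mult_sin)
  thus ?thesis using fps_cos_nonzero mult_right_cancel by blast
qed

text \<open>The derivative of \<open>tan_sec_square\<close>. The product on the right matches the
  cut of a word at its minimum: one factor for the left part, and a differentiated one for the right
  part, which contains the maximum.\<close>

lemma deriv2_tan_sec: "fps_deriv (fps_deriv fps_tan_sec) = fps_tan_sec * fps_deriv fps_tan_sec"
proof -
  have "fps_deriv (fps_tan_sec * fps_tan_sec) = fps_deriv (2 * fps_deriv fps_tan_sec - 1)"
    by (simp only: tan_sec_square)
  hence "2 * fps_deriv (fps_deriv fps_tan_sec) = 2 * (fps_tan_sec * fps_deriv fps_tan_sec)"
    by (simp add: algebra_simps)
  thus ?thesis by simp
qed

lemma fps_tan_sec_0: "fps_nth fps_tan_sec 0 = 1"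
proof -
  have "fps_nth (fps_tan_sec * fps_cos 1) 0 = fps_nth (1 + fps_sin 1) 0"
    by (simp only: tan_sec_mult_cos)
  thus ?thesis by simp
qed

lemma fps_tan_sec_1: "fps_nth (fps_deriv fps_tan_sec) 0 = 1"
proof -
  have "fps_nth (fps_deriv fps_tan_sec * fps_cos 1) 0 = fps_nth fps_tan_sec 0"
    by (simp only: deriv_tan_sec_mult_cos)
  thus ?thesis by (simp add: fps_tan_sec_0 del: fps_deriv_nth)
qed


section \<open>Addition theorems in split variables\<close>

text \<open>The two factors vanish outside complementary label ranges, so only
  \<open>T = S \<inter> X\<close> contributes.\<close>

lemma sval_egf_mult_Compl:
  assumes "finite S"
  shows "sval (egf A X * egf B (- X)) S =
    fact (card (S \<inter> X)) * fps_nth A (card (S \<inter> X)) * (fact (card (S - X)) * fps_nth B (card (S - X)))"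
proof -
  have "sval (egf A X * egf B (- X)) S =
      (\<Sum>T\<in>{S \<inter> X}. sval (egf A X) T * sval (egf B (- X)) (S - T))"
    unfolding sval_mult using assms
    by (intro sum.mono_neutral_right) (auto simp: sval_egf)
  moreover have "S - S \<inter> X = S - X" "S - X \<subseteq> - X" by auto
  ultimately show ?thesis using assms by (simp add: sval_egf)
qed

lemma fact_cos_sin_Suc:
  "fact (Suc n) * fps_nth (fps_cos 1) (Suc n) = - (fact n * fps_nth (fps_sin 1) n :: real)"
  "fact (Suc n) * fps_nth (fps_sin 1) (Suc n) = (fact n * fps_nth (fps_cos 1) n :: real)"
proof -
  have "fps_nth (fps_deriv (fps_cos 1)) n = - (fps_nth (fps_sin 1) n :: real)"
    by (simp only: fps_cos_deriv_1 fps_neg_nth)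
  thus "fact (Suc n) * fps_nth (fps_cos 1) (Suc n) = - (fact n * fps_nth (fps_sin 1) n :: real)"
    by (simp add: mult.assoc mult.left_commute)
  have "fps_nth (fps_deriv (fps_sin 1)) n = (fps_nth (fps_cos 1) n :: real)"
    by (simp only: fps_sin_deriv_1)
  thus "fact (Suc n) * fps_nth (fps_sin 1) (Suc n) = (fact n * fps_nth (fps_cos 1) n :: real)"
    by (simp add: mult.assoc mult.left_commute)
qed

text \<open>The addition theorems read off coefficientwise: \<open>Suc\<close> exchanges
  \<open>c\<close> and \<open>s\<close> up to sign, which drives the induction.\<close>

lemma fact_cos_sin_add:
  fixes c s :: "nat \<Rightarrow> real"
  defines "c \<equiv> \<lambda>n. fact n * fps_nth (fps_cos 1) n" and "s \<equiv> \<lambda>n. fact n * fps_nth (fps_sin 1) n"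
  shows "c (m + n) = c m * c n - s m * s n \<and> s (m + n) = s m * c n + c m * s n"
proof (induction m)
  case 0
  show ?case by (simp add: c_def s_def)
next
  case (Suc m)
  have "c (Suc k) = - s k" "s (Suc k) = c k" for k
    by (simp_all only: c_def s_def fact_cos_sin_Suc)
  thus ?case using Suc by simp
qed

lemma egf_cos_split:
  "egf (fps_cos 1) UNIV = egf (fps_cos 1) X * egf (fps_cos 1) (- X) - egf (fps_sin 1) X * egf (fps_sin 1) (- X)"
  and egf_sin_split:
  "egf (fps_sin 1) UNIV = egf (fps_sin 1) X * egf (fps_cos 1) (- X) + egf (fps_cos 1) X * egf (fps_sin 1) (- X)"
proof (safe intro!: sfun_eqI)
  fix S :: "'a set"
  assume fin: "finite S"
  have v: "sval (egf A UNIV) S =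
      fact (card (S \<inter> X) + card (S - X)) * fps_nth A (card (S \<inter> X) + card (S - X))" for A
    using fin card_Int_Diff [OF fin, of X] by (simp add: sval_egf)
  show "sval (egf (fps_cos 1) UNIV) S =
      sval (egf (fps_cos 1) X * egf (fps_cos 1) (- X) - egf (fps_sin 1) X * egf (fps_sin 1) (- X)) S"
    unfolding v sval_diff sval_egf_mult_Compl [OF fin] by (rule conjunct1 [OF fact_cos_sin_add])
  show "sval (egf (fps_sin 1) UNIV) S =
      sval (egf (fps_sin 1) X * egf (fps_cos 1) (- X) + egf (fps_cos 1) X * egf (fps_sin 1) (- X)) S"
    unfolding v sval_add sval_egf_mult_Compl [OF fin] by (rule conjunct2 [OF fact_cos_sin_add])
qed

lemma egf_sin_cos_squares:
  "egf (fps_sin 1) X * egf (fps_sin 1) X = 1 - egf (fps_cos 1) X * egf (fps_cos 1) X"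
  by (simp add: sin_cos_squares egf_diff flip: egf_mult)

text \<open>The sum of the variables outside \<open>X\<close> is the total minus the sum over
  \<open>X\<close>, so this is the subtraction theorem for the cosine.\<close>

lemma egf_cos_Compl:
  "egf (fps_cos 1) (- X) =
    egf (fps_cos 1) UNIV * egf (fps_cos 1) X + egf (fps_sin 1) UNIV * egf (fps_sin 1) X"
proof -
  \<comment> \<open>With \<open>c\<close>, \<open>s\<close> for \<open>X\<close> and
    \<open>c'\<close>, \<open>s'\<close> for the complement, the addition theorems leave a
    polynomial identity modulo \<open>s * s = 1 - c * c\<close>.\<close>
  have alg: "c' = (c * c' - s * s') * c + (s * c' + c * s') * s"
    if "s * s = 1 - c * c" for c s c' s' :: "'a sfun"
  proof -
    have "(c * c' - s * s') * c + (s * c' + c * s') * s = c' * (c * c + s * s)"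
      by (simp add: algebra_simps)
    thus ?thesis by (simp add: that)
  qed
  show ?thesis
    unfolding egf_cos_split [of X] egf_sin_split [of X] by (rule alg [OF egf_sin_cos_squares])
qed

lemma egf_sin_Compl:
  "egf (fps_sin 1) (- X) =
    egf (fps_sin 1) UNIV * egf (fps_cos 1) X - egf (fps_cos 1) UNIV * egf (fps_sin 1) X"
proof -
  have alg: "s' = (s * c' + c * s') * c - (c * c' - s * s') * s"
    if "s * s = 1 - c * c" for c s c' s' :: "'a sfun"
  proof -
    have "(s * c' + c * s') * c - (c * c' - s * s') * s = s' * (c * c + s * s)"
      by (simp add: algebra_simps)
    thus ?thesis by (simp add: that)
  qed
  show ?thesis
    unfolding egf_cos_split [of X] egf_sin_split [of X] by (rule alg [OF egf_sin_cos_squares])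
qed

abbreviation "Cos \<equiv> egf (fps_cos 1)"
abbreviation "Sin \<equiv> egf (fps_sin 1)"
abbreviation "TS \<equiv> egf fps_tan_sec UNIV"
abbreviation "TS' \<equiv> egf (fps_deriv fps_tan_sec) UNIV"

lemma TS_identities:
  "TS * Cos UNIV = 1 + Sin UNIV"
  "TS * Sin UNIV = TS - Cos UNIV"
  "TS' * Cos UNIV = TS"
  "TS' * Sin UNIV = TS' - 1"
  "TS * TS = 2 * TS' - 1"
proof -
  show "TS * Cos UNIV = 1 + Sin UNIV"
    by (simp add: tan_sec_mult_cos egf_add flip: egf_mult)
  show "TS * Sin UNIV = TS - Cos UNIV"
    by (simp add: tan_sec_mult_sin egf_diff flip: egf_mult)
  show "TS' * Cos UNIV = TS"
    by (simp add: deriv_tan_sec_mult_cos flip: egf_mult)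
  show "TS' * Sin UNIV = TS' - 1"
    by (simp add: deriv_tan_sec_mult_sin egf_diff flip: egf_mult)
  show "TS * TS = 2 * TS' - 1"
    unfolding mult_2 egf_add [symmetric] egf_mult [symmetric] egf_one [symmetric]
      egf_diff [symmetric] by (simp only: tan_sec_square mult_2 egf_diff egf_one)
qed

text \<open>With \<open>u\<close> the sum of all variables, the subtraction theorems expand the left
  side, and \<open>E cos u = 1 + sin u\<close> and \<open>E sin u = E - cos u\<close> cancel all
  terms in \<open>u\<close>. It passes from the labels above a letter to those below it.\<close>

lemma TS_Compl: "Cos (- X) + TS * Sin (- X) = TS * Cos X - Sin X"
proof -
  have alg: "(C * c + S * s) + e * (S * c - C * s) = e * c - s"
    if "e * C = 1 + S" "e * S = e - C" for e C S c s :: "'a sfun"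
  proof -
    have "(C * c + S * s) + e * (S * c - C * s) = C * c + S * s + (e * S) * c - (e * C) * s"
      by (simp add: algebra_simps)
    thus ?thesis unfolding that by (simp add: algebra_simps)
  qed
  show ?thesis
    unfolding egf_cos_Compl egf_sin_Compl by (rule alg [OF TS_identities(1,2)])
qed

lemma sderiv_TS: "sderiv a TS TS'"
  by (rule sderiv_egf_in) simp

lemma sderiv_TS': "sderiv a TS' (TS * TS')"
  using sderiv_egf_in [of a UNIV "fps_deriv fps_tan_sec"] by (simp add: deriv2_tan_sec egf_mult)

lemma sderiv_Cos: "a \<in> X \<Longrightarrow> sderiv a (Cos X) (- Sin X)"
  and sderiv_Sin: "a \<in> X \<Longrightarrow> sderiv a (Sin X) (Cos X)"
  using sderiv_egf_in [of a X "fps_cos 1"] sderiv_egf_in [of a X "fps_sin 1"]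
  by (simp_all add: fps_cos_deriv_1 fps_sin_deriv_1 egf_uminus)


section \<open>Decomposing Andre words at their minimum\<close>

text \<open>Cutting at the minimum leads to arbitrary letter sets, so the inductions cannot stay
  with \<open>{1..n}\<close>.\<close>

definition andre_words :: "nat set \<Rightarrow> nat list set" where
  "andre_words Y = {w \<in> permutations_of_set Y. andre_I w}"

lemma And_I_eq: "And_I n = andre_words {1..n}"
  by (simp add: And_I_def andre_words_def)

lemma andre_words_iff: "w \<in> andre_words Y \<longleftrightarrow> distinct w \<and> set w = Y \<and> andre_I w"
  by (auto simp: andre_words_def permutations_of_set_def)

lemma finite_andre_words [simp]: "finite (andre_words Y)"
  by (simp add: andre_words_def)

lemma andre_words_empty: "andre_words {} = {[]}"
  by (auto simp: andre_words_iff intro: andre_I.intros)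

lemma andre_words_singleton: "0 < x \<Longrightarrow> andre_words {x} = {[x]}"
  by (auto simp: andre_words_def permutations_of_set_singleton intro: andre_I.singleton)

text \<open>The minimum occurs once in a distinct word, so the cut produced by
  \<open>andre_I.split\<close> is the given one.\<close>

lemma andre_I_append_iff:
  assumes "distinct (v @ x # v')" "x = Min (set (v @ x # v'))" "v @ v' \<noteq> []"
  shows "andre_I (v @ x # v') \<longleftrightarrow>
    0 < x \<and> andre_I v \<and> andre_I v' \<and> Max (set (v @ v')) \<in> set v'"
proof
  assume "andre_I (v @ x # v')"
  thus "0 < x \<and> andre_I v \<and> andre_I v' \<and> Max (set (v @ v')) \<in> set v'"
  proof cases
    case (split u u' y)
    have "y = x" using split(1,5) assms(2) by simp
    moreover have "x \<notin> set v" "x \<notin> set v'" using assms(1) by auto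
    ultimately have "y = x" "u = v" "u' = v'"
      using split(1) append_Cons_eq_iff [of x v v' u u'] by auto
    thus ?thesis using split by simp
  qed (use assms(3) in \<open>auto simp: append_eq_Cons_conv\<close>)
next
  assume "0 < x \<and> andre_I v \<and> andre_I v' \<and> Max (set (v @ v')) \<in> set v'"
  thus "andre_I (v @ x # v')"
    using assms by (intro andre_I.split) auto
qed

text \<open>\<open>T\<close> is the set of letters left of the minimum \<open>x\<close>. The maximum
  \<open>M\<close> must stand on the right, so only the letters of \<open>S\<close> are distributed.
  The predicate \<open>R\<close> carries whatever statistic is being counted.\<close>

lemma card_andre_words_split:
  assumes S: "finite S" "\<forall>y\<in>S. x < y \<and> y < M" and x: "0 < x" "x < M"
  shows "card {w \<in> andre_words (insert x (insert M S)). R w} =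
    (\<Sum>T\<in>Pow S. card {(v, v') \<in> andre_words T \<times> andre_words (insert M (S - T)). R (v @ x # v')})"
proof -
  let ?Y = "insert x (insert M S)"
  let ?D = "SIGMA T:Pow S. {(v, v') \<in> andre_words T \<times> andre_words (insert M (S - T)). R (v @ x # v')}"
  let ?f = "\<lambda>(T :: nat set, v, v'). v @ x # v'"
  have notin: "x \<notin> S" "M \<notin> S" using S by auto
  have Min: "Min ?Y = x" using S x by (intro Min_eqI) (auto dest: less_imp_le)
  have Max: "Max (insert M S) = M" using S x by (intro Max_eqI) (auto dest: less_imp_le)
  \<comment> \<open>\<open>x\<close> occurs once, so the word determines \<open>v\<close> and
    \<open>v'\<close>, and \<open>T\<close> is the letter set of \<open>v\<close>.\<close>
  have "inj_on ?f ?D"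
  proof (rule inj_onI)
    fix d e
    assume "d \<in> ?D" "e \<in> ?D" "?f d = ?f e"
    then obtain T v v' U u u' where *: "d = (T, v, v')" "e = (U, u, u')" "T \<subseteq> S"
      "v \<in> andre_words T" "v' \<in> andre_words (insert M (S - T))" "u \<in> andre_words U"
      "v @ x # v' = u @ x # u'"
      by auto
    hence "x \<notin> set v" "x \<notin> set v'" using notin x by (auto simp: andre_words_iff)
    hence "v = u" "v' = u'" using *(7) append_Cons_eq_iff [of x v v' u u'] by auto
    thus "d = e" using * by (auto simp: andre_words_iff)
  qed
  moreover have "?f ` ?D = {w \<in> andre_words ?Y. R w}"
  proof (intro set_eqI iffI)
    fix w
    assume "w \<in> ?f ` ?D"
    then obtain T v v' where *: "w = v @ x # v'" "T \<subseteq> S" "v \<in> andre_words T"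
      "v' \<in> andre_words (insert M (S - T))" "R w" by auto
    hence d: "distinct (v @ x # v')" using notin x by (auto simp: andre_words_iff)
    have set: "set (v @ x # v') = ?Y" "set (v @ v') = insert M S"
      using * by (auto simp: andre_words_iff)
    have "andre_I (v @ x # v') \<longleftrightarrow>
        0 < x \<and> andre_I v \<and> andre_I v' \<and> Max (set (v @ v')) \<in> set v'"
      using set d Min by (intro andre_I_append_iff) auto
    hence "andre_I w" using * x Max unfolding set by (simp add: andre_words_iff)
    moreover have "distinct w" "set w = ?Y" using d set *(1) by (simp_all only:)
    ultimately show "w \<in> {w \<in> andre_words ?Y. R w}" using *(5) by (simp add: andre_words_iff)
  next
    fix w
    assume "w \<in> {w \<in> andre_words ?Y. R w}"
    hence w: "distinct w" "set w = ?Y" "andre_I w" "R w" by (auto simp: andre_words_iff)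
    then obtain v v' where v: "w = v @ x # v'" by (metis insertI1 in_set_conv_decomp)
    have set: "set (v @ v') = insert M S" using w v notin x by auto
    have "andre_I (v @ x # v') \<longleftrightarrow>
        0 < x \<and> andre_I v \<and> andre_I v' \<and> Max (set (v @ v')) \<in> set v'"
      using set w v Min by (intro andre_I_append_iff) auto
    hence "andre_I v" "andre_I v'" "M \<in> set v'"
      using w v Max unfolding set by auto
    moreover have "set v \<inter> set v' = {}" "distinct v" "distinct v'" using w v by auto
    ultimately have "(set v, v, v') \<in> ?D"
      using w v set by (auto simp: andre_words_iff)
    from rev_image_eqI [OF this, of w ?f] show "w \<in> ?f ` ?D" using v by simp
  qed
  ultimately have "card {w \<in> andre_words ?Y. R w} = card ?D"
    using card_image [of ?f ?D] by simp
  also have "\<dots> = (\<Sum>T\<in>Pow S. card {(v, v') \<in> andre_words T \<times> andre_words (insert M (S - T)). R (v @ x # v')})"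
  proof (intro card_SigmaI ballI)
    show "finite {(v, v') \<in> andre_words T \<times> andre_words (insert M (S - T)). R (v @ x # v')}" for T
      by (rule finite_subset [of _ "andre_words T \<times> andre_words (insert M (S - T))"]) auto
  qed (use S(1) in simp)
  finally show ?thesis .
qed

lemma next_to_last_append:
  assumes "v' \<noteq> []"
  shows "next_to_last (v @ x # v') = (if length v' = 1 then x else next_to_last v')"
proof (cases "length v' = 1")
  case True
  thus ?thesis by (simp add: next_to_last_def nth_append)
next
  case False
  hence "length v' \<ge> 2" using assms by (cases v') (auto simp: Suc_le_eq)
  then obtain k where "length v' = Suc (Suc k)" by (metis add_2_eq_Suc le_Suc_ex)
  thus ?thesis by (simp add: next_to_last_def nth_append)
qed

lemma next_to_last_in_set: "2 \<le> length w \<Longrightarrow> next_to_last w \<in> set w"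
  by (simp add: next_to_last_def)

text \<open>A nonempty left part would supply the first letter and omits \<open>x\<close>, so only
  \<open>T = {}\<close> survives in the sum.\<close>

lemma card_andre_words_hd_Min:
  assumes S: "finite S" "\<forall>y\<in>S. x < y \<and> y < M" and x: "0 < x" "x < M"
  shows "card {w \<in> andre_words (insert x (insert M S)). hd w = x \<and> R w} =
    card {w \<in> andre_words (insert M S). R (x # w)}"
proof -
  let ?c = "\<lambda>T. card {(v, v') \<in> andre_words T \<times> andre_words (insert M (S - T)).
    hd (v @ x # v') = x \<and> R (v @ x # v')}"
  have "?c T = 0" if "T \<in> Pow S - {{}}" for T
  proof -
    have "hd (v @ x # v') \<in> T" if "v \<in> andre_words T" for v v'
      using that \<open>T \<in> Pow S - {{}}\<close> by (cases v) (auto simp: andre_words_iff)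
    moreover have "x \<notin> T" using that S by auto
    ultimately have "hd (v @ x # v') \<noteq> x" if "v \<in> andre_words T" for v v'
      using that by metis
    thus ?thesis by (auto simp: card_eq_0_iff)
  qed
  hence "sum ?c (Pow S) = sum ?c {{}}"
    using S(1) by (intro sum.mono_neutral_right) auto
  moreover have "{(v, v') \<in> andre_words {} \<times> andre_words (insert M (S - {})).
      hd (v @ x # v') = x \<and> R (v @ x # v')} = {[]} \<times> {w \<in> andre_words (insert M S). R (x # w)}"
    by (auto simp: andre_words_empty)
  hence "sum ?c {{}} = card {w \<in> andre_words (insert M S). R (x # w)}"
    by (simp add: card_cartesian_product)
  ultimately have "sum ?c (Pow S) = card {w \<in> andre_words (insert M S). R (x # w)}" by (rule trans)
  thus ?thesis by (rule trans [OF card_andre_words_split [OF assms, of "\<lambda>w. hd w = x \<and> R w"]])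
qed

text \<open>A right part with further letters besides \<open>M\<close> would contain the
  next-to-last letter, so only \<open>T = S\<close> survives and the word ends in \<open>x\<close>,
  \<open>M\<close>.\<close>

lemma card_andre_words_next_to_last_Min:
  assumes S: "finite S" "\<forall>y\<in>S. x < y \<and> y < M" and x: "0 < x" "x < M"
  shows "card {w \<in> andre_words (insert x (insert M S)). R w \<and> next_to_last w = x} =
    card {w \<in> andre_words S. R (w @ [x, M])}"
proof -
  let ?c = "\<lambda>T. card {(v, v') \<in> andre_words T \<times> andre_words (insert M (S - T)).
    R (v @ x # v') \<and> next_to_last (v @ x # v') = x}"
  have "?c T = 0" if "T \<in> Pow S - {S}" for T
  proof -
    have "next_to_last (v @ x # v') \<in> insert M (S - T)" if "v' \<in> andre_words (insert M (S - T))" for v v'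
    proof -
      have "card (insert M (S - T)) \<ge> 2"
        using \<open>T \<in> Pow S - {S}\<close> S by (subst card_insert_disjoint) (auto simp: Suc_le_eq card_gt_0_iff)
      moreover have "length v' = card (insert M (S - T))" "set v' = insert M (S - T)"
        using that by (auto simp: andre_words_iff distinct_card [symmetric])
      ultimately show ?thesis
        using next_to_last_in_set [of v'] by (subst next_to_last_append) auto
    qed
    moreover have "x \<notin> insert M (S - T)" using S x by auto
    ultimately have "next_to_last (v @ x # v') \<noteq> x" if "v' \<in> andre_words (insert M (S - T))" for v v'
      using that by metis
    thus ?thesis by (auto simp: card_eq_0_iff)
  qed
  hence "sum ?c (Pow S) = sum ?c {S}"
    using S(1) by (intro sum.mono_neutral_right) auto
  moreover have "{(v, v') \<in> andre_words S \<times> andre_words (insert M (S - S)).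
      R (v @ x # v') \<and> next_to_last (v @ x # v') = x} = {w \<in> andre_words S. R (w @ [x, M])} \<times> {[M]}"
    using x by (auto simp: andre_words_singleton next_to_last_append)
  hence "sum ?c {S} = card {w \<in> andre_words S. R (w @ [x, M])}"
    by (simp add: card_cartesian_product)
  ultimately have "sum ?c (Pow S) = card {w \<in> andre_words S. R (w @ [x, M])}" by (rule trans)
  thus ?thesis by (rule trans [OF card_andre_words_split [OF assms, of "\<lambda>w. R w \<and> next_to_last w = x"]])
qed


section \<open>Closed forms for the counting functions\<close>

lemma insert_Min_Max_cases:
  fixes S :: "'a :: linorder set"
  assumes "finite S"
  obtains "S = {}" | x where "S = {x}"
  | x M S' where "S = insert x (insert M S')" "x < M" "\<forall>y\<in>S'. x < y \<and> y < M"
proof (cases "S = {} \<or> (\<exists>x. S = {x})")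
  case True
  thus ?thesis using that by blast
next
  case False
  hence ne: "S \<noteq> {}" by simp
  have lt: "Min S < Max S"
  proof -
    have "Min S \<noteq> Max S"
      using False ne assms by (metis Min.coboundedI Max.coboundedI antisym is_singletonI' is_singletonE)
    thus ?thesis using assms ne by (simp add: le_neq_trans)
  qed
  show ?thesis
  proof (rule that(3) [of "Min S" "Max S" "S - {Min S, Max S}"])
    show "S = insert (Min S) (insert (Max S) (S - {Min S, Max S}))"
      using assms ne Min_in Max_in by blast
    show "\<forall>y\<in>S - {Min S, Max S}. Min S < y \<and> y < Max S"
      using Min_le [OF assms] Max_ge [OF assms] by (auto simp: less_le)
  qed (fact lt)
qed

text \<open>The sum over the cuts is the coefficient of \<open>TS * TS'\<close> on
  \<open>S'\<close>. Since \<open>E'' = E E'\<close>, it is the second derivative of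
  \<open>TS\<close> in the variables of \<open>M\<close> and \<open>x\<close>.\<close>

lemma card_andre_words:
  assumes "finite S" "0 \<notin> S"
  shows "real (card (andre_words S)) = sval TS S"
  using assms
proof (induction "card S" arbitrary: S rule: less_induct)
  case less
  from less.prems(1) show ?case
  proof (cases rule: insert_Min_Max_cases)
    case 1
    thus ?thesis using fps_tan_sec_0 by (simp add: andre_words_empty sval_egf)
  next
    case (2 x)
    thus ?thesis using fps_tan_sec_1 less.prems by (simp add: andre_words_singleton sval_egf)
  next
    case (3 x M S')
    hence S': "finite S'" "x \<notin> S'" "M \<notin> S'" "0 \<notin> S'" "0 < x" using less.prems by auto
    have card: "card S = Suc (Suc (card S'))"
      using 3 S' by (subst 3(1)) (auto simp: card_insert_if)
    have "card (andre_words S) = card {w \<in> andre_words (insert x (insert M S')). True}"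
      using 3 by simp
    also have "\<dots> = (\<Sum>T\<in>Pow S'. card {(v, v') \<in> andre_words T \<times> andre_words (insert M (S' - T)). True})"
      by (rule card_andre_words_split) (use 3 S' in auto)
    also have "\<dots> = (\<Sum>T\<in>Pow S'. card (andre_words T) * card (andre_words (insert M (S' - T))))"
      by (simp add: card_cartesian_product)
    also have "real \<dots> = (\<Sum>T\<in>Pow S'. sval TS T * sval TS' (S' - T))"
      unfolding of_nat_sum of_nat_mult
    proof (intro sum.cong refl)
      fix T
      assume T: "T \<in> Pow S'"
      hence fin: "finite T" "card T \<le> card S'" "card (S' - T) \<le> card S'"
        using S' by (auto intro: finite_subset card_mono)
      have "real (card (andre_words T)) = sval TS T"
        using fin card T S' by (intro less.hyps) auto
      moreover have "real (card (andre_words (insert M (S' - T)))) = sval TS (insert M (S' - T))"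
        using fin card T S' 3(2) by (intro less.hyps) (auto simp: card_insert_if)
      moreover have "sval TS (insert M (S' - T)) = sval TS' (S' - T)"
        using S' by (intro sderivD [OF sderiv_TS]) auto
      ultimately show "real (card (andre_words T)) * real (card (andre_words (insert M (S' - T))))
          = sval TS T * sval TS' (S' - T)" by simp
    qed
    also have "\<dots> = sval (TS * TS') S'" by (simp add: sval_mult)
    also have "\<dots> = sval TS' (insert M S')"
      using S' by (intro sderivD [OF sderiv_TS', symmetric]) auto
    also have "\<dots> = sval TS S"
      using S' 3 by (subst 3(1), intro sderivD [OF sderiv_TS, symmetric]) auto
    finally show ?thesis .
  qed
qed

section \<open>Counting words with marked letters\<close>

text \<open>The marked letter is kept apart from \<open>S\<close>: only the remaining letters carry
  variables.\<close>

definition count_first :: "nat \<Rightarrow> nat set \<Rightarrow> nat" where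
  "count_first p S = card {w \<in> andre_words (insert p S). hd w = p}"

text \<open>\<open>M\<close> stands for the maximum. It stays apart from \<open>S\<close> too, since
  every cut leaves it in the right part together with \<open>r\<close>.\<close>

definition count_ntl :: "nat \<Rightarrow> nat \<Rightarrow> nat set \<Rightarrow> nat" where
  "count_ntl r M S = card {w \<in> andre_words (insert M (insert r S)). next_to_last w = r}"

definition count_joint :: "nat \<Rightarrow> nat \<Rightarrow> nat \<Rightarrow> nat set \<Rightarrow> nat" where
  "count_joint p r M S =
    card {w \<in> andre_words (insert M (insert r (insert p S))). hd w = p \<and> next_to_last w = r}"

text \<open>The function is evaluated on sets without \<open>p\<close>, so the range
  \<open>{p..}\<close> means the labels above \<open>p\<close>; in this form it is the complement of
  \<open>{..<p}\<close>, as \<open>TS_Compl\<close> requires.\<close>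

abbreviation first_sfun :: "nat \<Rightarrow> nat sfun" where
  "first_sfun p \<equiv> Cos {p..} + TS * Sin {p..}"

lemma sagree_id_refl: "sagree (\<lambda>x. x) S f f"
  by (simp add: sagree_def)

lemma sagree_egf_UNIV: "S \<subseteq> X \<Longrightarrow> sagree (\<lambda>x. x) S (egf A X) (egf A UNIV)"
  by (rule sagree_egf) auto

text \<open>Let \<open>f = cos z + E sin z\<close>. If \<open>p\<close> is the minimum, the rest of
  the word is arbitrary; if it is the maximum of several letters, no word starts with it. Otherwise
  the cut puts \<open>p\<close> on the left, and \<open>f E'\<close> is the derivative of
  \<open>f\<close> in one variable below \<open>p\<close> and one above.\<close>

lemma count_first_eq:
  assumes "finite S" "0 \<notin> S" "0 < p" "p \<notin> S"
  shows "real (count_first p S) = sval (first_sfun p) S"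
  using assms(1,2,4)
proof (induction "card S" arbitrary: S rule: less_induct)
  case less
  have small: "sval (first_sfun p) S = sval 1 S" if "S \<inter> {p..} = {}"
  proof -
    have "sagree (\<lambda>x. x) S (first_sfun p) (1 + TS * 0)"
      using that by (intro sagree_add sagree_mult sagree_id_refl sagree_egf_disjoint) auto
    from sagreeD [OF this] show ?thesis by simp
  qed
  from less.prems(1) have "finite (insert p S)" by simp
  thus ?case
  proof (cases rule: insert_Min_Max_cases)
    case 1
    thus ?thesis by simp
  next
    case (2 x)
    hence "S = {}" using less.prems by auto
    moreover have "{w. w = [p] \<and> hd w = p} = {[p]}" by auto
    ultimately show ?thesis
      using small assms(3) by (simp add: count_first_def andre_words_singleton sval_one)
  next
    case (3 x M Y)
    have "finite (insert x (insert M Y))" "0 \<notin> insert x (insert M Y)"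
      using less.prems assms(3) unfolding 3(1) [symmetric] by simp_all
    hence Y: "finite Y" "x \<notin> Y" "M \<notin> Y" "0 \<notin> Y" "0 < x"
      using 3(3) by auto
    have S_eq: "S = insert x (insert M Y) - {p}"
      using 3(1) less.prems(3) by (metis Diff_insert_absorb)
    consider "p = x" | "p = M" | "p \<in> Y" using 3(1) by auto
    thus ?thesis
    proof cases
      case 1
      hence S: "S = insert M Y" using 3(2) Y S_eq by auto
      have "count_first p S = card {w \<in> andre_words (insert M Y). True}"
        unfolding count_first_def S 1
        using card_andre_words_hd_Min [of Y x M "\<lambda>_. True"] 3 Y by simp
      also have "real \<dots> = sval TS S"
        using card_andre_words [of S] less.prems S by simp
      \<comment> \<open>All remaining labels exceed \<open>p\<close>, so \<open>z\<close> is the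
        total sum and \<open>E sin u = E - cos u\<close> applies.\<close>
      also have "\<dots> = sval (Cos UNIV + TS * Sin UNIV) S"
        by (simp add: TS_identities)
      also have "\<dots> = sval (first_sfun p) S"
      proof -
        have "S \<subseteq> {p..}" using S 1 3 by (auto dest: less_imp_le)
        hence "sagree (\<lambda>x. x) S (first_sfun p) (Cos UNIV + TS * Sin UNIV)"
          by (intro sagree_add sagree_mult sagree_id_refl sagree_egf_UNIV)
        from sagreeD [OF this] show ?thesis by simp
      qed
      finally show ?thesis .
    next
      case 2
      hence S: "S = insert x Y" using 3(2) Y S_eq by auto
      have "count_first p S = (\<Sum>T\<in>Pow Y. card {(v, v') \<in> andre_words T \<times> andre_words (insert M (Y - T)). hd (v @ x # v') = p})"
        unfolding count_first_def 3(1) by (rule card_andre_words_split) (use 3 Y in auto)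
      also have "\<dots> = 0"
      proof (intro sum.neutral ballI)
        fix T
        assume "T \<in> Pow Y"
        hence "hd (v @ x # v') \<noteq> p" if "v \<in> andre_words T" for v v'
          using that 2 3 Y by (cases v) (auto simp: andre_words_iff)
        thus "card {(v, v') \<in> andre_words T \<times> andre_words (insert M (Y - T)). hd (v @ x # v') = p} = 0"
          by (auto simp: card_eq_0_iff)
      qed
      finally have "count_first p S = 0" .
      moreover have "S \<inter> {p..} = {}" using S 2 3 by (auto simp: not_le)
      ultimately show ?thesis using small S by (simp add: sval_one)
    next
      case 3
      note xM = \<open>insert p S = insert x (insert M Y)\<close> \<open>x < M\<close> \<open>\<forall>y\<in>Y. x < y \<and> y < M\<close>
      define S' where "S' = Y - {p}"
      have Y': "Y = insert p S'" using 3 by (auto simp: S'_def)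
      have S': "finite S'" "p \<notin> S'" "0 \<notin> S'" "x \<notin> S'" "M \<notin> S'" using Y by (auto simp: S'_def)
      have S: "S = insert x (insert M S')"
        using xM(2) 3 Y S_eq by (auto simp: S'_def)
      have card: "card S = Suc (Suc (card S'))"
        using S' xM by (subst S) (auto simp: card_insert_if)
      have p: "x < p" "p < M" using xM 3 by auto
      let ?c = "\<lambda>T. card {(v, v') \<in> andre_words T \<times> andre_words (insert M (Y - T)). hd (v @ x # v') = p}"
      have "count_first p S = (\<Sum>T\<in>Pow Y. ?c T)"
        unfolding count_first_def xM(1) by (rule card_andre_words_split) (use xM Y in auto)
      also have "\<dots> = (\<Sum>T\<in>Pow S'. ?c T) + (\<Sum>T\<in>Pow S'. ?c (insert p T))"
        unfolding Y' by (rule sum_Pow_insert) (use S' in auto)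
      \<comment> \<open>With \<open>p\<close> right of the cut, the word begins with a letter of
        \<open>T\<close> or with \<open>x\<close>.\<close>
      also have "(\<Sum>T\<in>Pow S'. ?c T) = 0"
      proof (intro sum.neutral ballI)
        fix T
        assume "T \<in> Pow S'"
        hence "hd (v @ x # v') \<noteq> p" if "v \<in> andre_words T" for v v'
          using that p S' by (cases v) (auto simp: andre_words_iff)
        thus "?c T = 0" by (auto simp: card_eq_0_iff)
      qed
      also have "real (0 + (\<Sum>T\<in>Pow S'. ?c (insert p T))) =
          (\<Sum>T\<in>Pow S'. sval (first_sfun p) T * sval TS' (S' - T))"
        unfolding add_0 of_nat_sum
      proof (intro sum.cong refl)
        fix T
        assume T: "T \<in> Pow S'"
        hence fin: "finite T" "card T \<le> card S'" using S' by (auto intro: finite_subset card_mono)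
        have YT: "Y - insert p T = S' - T" using Y' S' by auto
        have hd: "hd (v @ x # v') = hd v" if "v \<in> andre_words (insert p T)" for v v'
          using that by (cases v) (auto simp: andre_words_iff)
        have "{(v, v') \<in> andre_words (insert p T) \<times> andre_words (insert M (Y - insert p T)). hd (v @ x # v') = p}
            = {v \<in> andre_words (insert p T). hd v = p} \<times> andre_words (insert M (S' - T))"
          unfolding YT by (auto simp: hd cong: conj_cong)
        hence "?c (insert p T) = count_first p T * card (andre_words (insert M (S' - T)))"
          by (simp only: card_cartesian_product count_first_def)
        moreover have "real (count_first p T) = sval (first_sfun p) T"
          using T S' fin card by (intro less.hyps) auto
        moreover have "real (card (andre_words (insert M (S' - T)))) = sval TS (insert M (S' - T))"
          using S' p by (intro card_andre_words) auto
        moreover have "sval TS (insert M (S' - T)) = sval TS' (S' - T)"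
          using S' by (intro sderivD [OF sderiv_TS]) auto
        ultimately show "real (?c (insert p T)) = sval (first_sfun p) T * sval TS' (S' - T)"
          by simp
      qed
      also have "\<dots> = sval (first_sfun p * TS') S'" by (simp add: sval_mult)
      \<comment> \<open>\<open>M\<close> lies above \<open>p\<close>, so both factors depend on its
        variable. In the step after this one \<open>x\<close> lies below \<open>p\<close>, and only
        \<open>TS\<close> depends on it.\<close>
      also have "\<dots> = sval (TS' * Sin {p..}) (insert M S')"
      proof -
        have "sderiv M (TS' * Sin {p..}) (TS * TS' * Sin {p..} + TS' * Cos {p..})"
          using p by (intro sderiv_mult sderiv_TS' sderiv_Sin) auto
        moreover have "TS * TS' * Sin {p..} + TS' * Cos {p..} = first_sfun p * TS'"
          by (simp add: algebra_simps)
        ultimately show ?thesis using S' sderivD by metis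
      qed
      also have "\<dots> = sval (first_sfun p) S"
      proof -
        have "sderiv x (first_sfun p) (0 + (TS' * Sin {p..} + TS * 0))"
          using p by (intro sderiv_add sderiv_mult sderiv_TS sderiv_egf_notin) auto
        from sderivD [OF this, of "insert M S'"] show ?thesis
          unfolding S using S' xM(2) by simp
      qed
      finally show ?thesis .
    qed
  qed
qed


lemma obtain_Min_less:
  fixes r :: "'a :: linorder"
  assumes "finite S" "r \<notin> S" "\<not> (\<forall>y\<in>S. r < y)"
  obtains x S' where "S = insert x S'" "finite S'" "x \<notin> S'" "x < r" "\<forall>y\<in>S'. x < y"
proof (rule that [of "Min S" "S - {Min S}"])
  have ne: "S \<noteq> {}" using assms(3) by auto
  show "S = insert (Min S) (S - {Min S})" using Min_in [OF assms(1) ne] by auto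
  obtain y where y: "y \<in> S" "y < r" using assms(2,3) by (metis linorder_neqE)
  thus "Min S < r" using Min_le [OF assms(1) y(1)] by simp
  show "\<forall>y\<in>S - {Min S}. Min S < y" using Min_le [OF assms(1)] by (auto simp: less_le)
qed (use assms(1) in auto)

lemma next_to_last_append_in_set:
  assumes "v' \<noteq> []"
  shows "next_to_last (v @ x # v') \<in> insert x (set v')"
proof (cases "length v' = 1")
  case False
  hence "length v' \<ge> 2" using assms by (cases v') (auto simp: Suc_le_eq)
  thus ?thesis using next_to_last_in_set [of v'] next_to_last_append [OF assms] by auto
qed (use next_to_last_append [OF assms] in auto)

lemma next_to_last_append_long:
  assumes "a \<in> set v'" "b \<in> set v'" "a \<noteq> b"
  shows "next_to_last (v @ x # v') = next_to_last v'"
proof -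
  have "card {a, b} \<le> card (set v')" using assms by (intro card_mono) auto
  also have "\<dots> \<le> length v'" by (rule card_length)
  finally have "length v' \<noteq> 1" using assms(3) by auto
  moreover have "v' \<noteq> []" using assms by auto
  ultimately show ?thesis by (simp add: next_to_last_append)
qed

text \<open>If \<open>r\<close> is the minimum, any word on \<open>S\<close> may precede
  \<open>r\<close>, \<open>M\<close>, and \<open>E = E' cos u\<close>. Otherwise the cut puts
  \<open>r\<close> on the right, and \<open>E (E' cos z)\<close> is the derivative of
  \<open>E' cos z\<close> in a variable below \<open>r\<close>, by
  \<open>E'' = E E'\<close>.\<close>

lemma count_ntl_eq:
  assumes "finite S" "\<forall>y\<in>S. 0 < y \<and> y < M" "0 < r" "r < M" "r \<notin> S"
  shows "real (count_ntl r M S) = sval (Cos {r..} * TS') S"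
  using assms(1,2,5)
proof (induction "card S" arbitrary: S rule: less_induct)
  case less
  show ?case
  proof (cases "\<forall>y\<in>S. r < y")
    case True
    have "count_ntl r M S = card {w \<in> andre_words S. True}"
      unfolding count_ntl_def insert_commute [of M r]
      using card_andre_words_next_to_last_Min [of S r M "\<lambda>_. True"] True less.prems assms(3,4)
      by simp
    also have "real \<dots> = sval TS S"
      using card_andre_words [of S] less.prems by auto
    also have "\<dots> = sval (Cos UNIV * TS') S"
      by (simp add: TS_identities mult.commute [of "Cos UNIV"])
    also have "\<dots> = sval (Cos {r..} * TS') S"
    proof -
      have "S \<subseteq> {r..}" using True by (auto dest: less_imp_le)
      hence "sagree (\<lambda>x. x) S (Cos {r..} * TS') (Cos UNIV * TS')"
        by (intro sagree_mult sagree_id_refl sagree_egf_UNIV)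
      from sagreeD [OF this] show ?thesis by simp
    qed
    finally show ?thesis .
  next
    case False
    with less.prems obtain x S' where
      S: "S = insert x S'" "finite S'" "x \<notin> S'" "x < r" "\<forall>y\<in>S'. x < y"
      using obtain_Min_less [of S r] by metis
    have S': "r \<notin> S'" "M \<notin> S'" "0 \<notin> S'" "0 < x" using less.prems S by auto
    let ?c = "\<lambda>T. card {(v, v') \<in> andre_words T \<times> andre_words (insert M (insert r S' - T)). next_to_last (v @ x # v') = r}"
    have set: "insert M (insert r S) = insert x (insert M (insert r S'))" using S by auto
    have "count_ntl r M S = (\<Sum>T\<in>Pow (insert r S'). ?c T)"
      unfolding count_ntl_def set
      by (rule card_andre_words_split) (use S less.prems assms in auto)
    also have "\<dots> = (\<Sum>T\<in>Pow S'. ?c T) + (\<Sum>T\<in>Pow S'. ?c (insert r T))"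
      by (rule sum_Pow_insert) (use S S' in auto)
    also have "(\<Sum>T\<in>Pow S'. ?c (insert r T)) = 0"
    proof (intro sum.neutral ballI)
      fix T
      assume "T \<in> Pow S'"
      have "next_to_last (v @ x # v') \<noteq> r" if "v' \<in> andre_words (insert M (insert r S' - insert r T))" for v v'
      proof -
        have set: "set v' = insert M (insert r S' - insert r T)"
          using that by (simp add: andre_words_iff)
        hence "v' \<noteq> []" by auto
        from next_to_last_append_in_set [OF this, of v x] show ?thesis
          unfolding set using S(4) assms(4) by auto
      qed
      thus "?c (insert r T) = 0" by (auto simp: card_eq_0_iff)
    qed
    also have "real ((\<Sum>T\<in>Pow S'. ?c T) + 0) = (\<Sum>T\<in>Pow S'. sval TS T * sval (Cos {r..} * TS') (S' - T))"
      unfolding add_0_right of_nat_sum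
    proof (intro sum.cong refl)
      fix T
      assume T: "T \<in> Pow S'"
      hence fin: "finite T" "card (S' - T) \<le> card S'" using S by (auto intro: finite_subset card_mono)
      have ST: "insert r S' - T = insert r (S' - T)" using T S' by auto
      \<comment> \<open>The right part contains both \<open>r\<close> and \<open>M\<close>, so the
        next-to-last position lies inside it.\<close>
      have ntl: "next_to_last (v @ x # v') = next_to_last v'"
        if "v' \<in> andre_words (insert M (insert r (S' - T)))" for v v'
        using that assms(4) by (intro next_to_last_append_long [of r _ M]) (auto simp: andre_words_iff)
      have "{(v, v') \<in> andre_words T \<times> andre_words (insert M (insert r S' - T)). next_to_last (v @ x # v') = r}
          = andre_words T \<times> {v' \<in> andre_words (insert M (insert r (S' - T))). next_to_last v' = r}"
        unfolding ST by (auto simp: ntl cong: conj_cong)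
      hence "?c T = card (andre_words T) * count_ntl r M (S' - T)"
        by (simp only: card_cartesian_product count_ntl_def)
      moreover have "real (card (andre_words T)) = sval TS T"
        using T S' fin by (intro card_andre_words) auto
      moreover have "real (count_ntl r M (S' - T)) = sval (Cos {r..} * TS') (S' - T)"
        using T S S' fin less.prems by (intro less.hyps) auto
      ultimately show "real (?c T) = sval TS T * sval (Cos {r..} * TS') (S' - T)" by simp
    qed
    also have "\<dots> = sval (TS * (Cos {r..} * TS')) S'" by (simp only: sval_mult [of TS])
    also have "\<dots> = sval (Cos {r..} * TS') S"
    proof -
      have "sderiv x (Cos {r..} * TS') (0 * TS' + Cos {r..} * (TS * TS'))"
        using S by (intro sderiv_mult sderiv_TS' sderiv_egf_notin) auto
      from sderivD [OF this S(2,3)] show ?thesis unfolding S(1) by (simp add: mult.left_commute)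
    qed
    finally show ?thesis .
  qed
qed

section \<open>Joint counts of first and next-to-last letter\<close>

text \<open>An unmarked minimum forces \<open>p\<close> to the left of the cut and \<open>r\<close>
  to the right, whatever their order, so the joint count reduces in one step to the two single
  counts.\<close>

lemma count_joint_split:
  assumes "finite S" "\<forall>y\<in>S. x < y \<and> y < M" "0 < x" "x < p" "p < M" "x < r" "r < M"
    "p \<noteq> r" "p \<notin> S" "r \<notin> S"
  shows "real (count_joint p r M (insert x S)) = sval (first_sfun p * (Cos {r..} * TS')) S"
proof -
  let ?c = "\<lambda>T. card {(v, v') \<in> andre_words T \<times> andre_words (insert M (insert r (insert p S) - T)).
    hd (v @ x # v') = p \<and> next_to_last (v @ x # v') = r}"
  have set: "insert M (insert r (insert p (insert x S))) = insert x (insert M (insert r (insert p S)))"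
    by auto
  have p0: "?c T = 0" if "p \<notin> T" for T
  proof -
    have "hd (v @ x # v') \<noteq> p" if "v \<in> andre_words T" for v v'
      using that \<open>p \<notin> T\<close> assms(4) by (cases v) (auto simp: andre_words_iff)
    thus ?thesis by (auto simp: card_eq_0_iff)
  qed
  have r0: "?c T = 0" if "r \<in> T" for T
  proof -
    have "next_to_last (v @ x # v') \<noteq> r" if "v' \<in> andre_words (insert M (insert r (insert p S) - T))" for v v'
    proof -
      have set: "set v' = insert M (insert r (insert p S) - T)"
        using that by (simp add: andre_words_iff)
      hence "v' \<noteq> []" by auto
      from next_to_last_append_in_set [OF this, of v x] show ?thesis
        unfolding set using assms(6,7) \<open>r \<in> T\<close> by auto
    qed
    thus ?thesis by (auto simp: card_eq_0_iff)
  qed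
  have "count_joint p r M (insert x S) = (\<Sum>T\<in>Pow (insert r (insert p S)). ?c T)"
    unfolding count_joint_def set by (rule card_andre_words_split) (use assms in auto)
  also have "\<dots> = (\<Sum>T\<in>Pow (insert p S). ?c T) + (\<Sum>T\<in>Pow (insert p S). ?c (insert r T))"
    by (rule sum_Pow_insert) (use assms in auto)
  also have "(\<Sum>T\<in>Pow (insert p S). ?c (insert r T)) = 0"
    by (intro sum.neutral ballI r0) auto
  also have "(\<Sum>T\<in>Pow (insert p S). ?c T) = (\<Sum>T\<in>Pow S. ?c T) + (\<Sum>T\<in>Pow S. ?c (insert p T))"
    by (rule sum_Pow_insert) (use assms in auto)
  also have "(\<Sum>T\<in>Pow S. ?c T) = 0"
    by (intro sum.neutral ballI p0) (use assms in auto)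
  also have "real (0 + (\<Sum>T\<in>Pow S. ?c (insert p T)) + 0) =
      (\<Sum>T\<in>Pow S. sval (first_sfun p) T * sval (Cos {r..} * TS') (S - T))"
    unfolding add_0 add_0_right of_nat_sum
  proof (intro sum.cong refl)
    fix T
    assume T: "T \<in> Pow S"
    hence fin: "finite T" using assms by (auto intro: finite_subset)
    have ST: "insert r (insert p S) - insert p T = insert r (S - T)" using T assms by auto
    have hd: "hd (v @ x # v') = hd v" if "v \<in> andre_words (insert p T)" for v v'
      using that by (cases v) (auto simp: andre_words_iff)
    have ntl: "next_to_last (v @ x # v') = next_to_last v'"
      if "v' \<in> andre_words (insert M (insert r (S - T)))" for v v'
      using that assms(7) by (intro next_to_last_append_long [of r _ M]) (auto simp: andre_words_iff)
    have "{(v, v') \<in> andre_words (insert p T) \<times> andre_words (insert M (insert r (insert p S) - insert p T)).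
          hd (v @ x # v') = p \<and> next_to_last (v @ x # v') = r}
        = {v \<in> andre_words (insert p T). hd v = p} \<times>
          {v' \<in> andre_words (insert M (insert r (S - T))). next_to_last v' = r}"
      unfolding ST by (auto simp: hd ntl cong: conj_cong)
    hence "?c (insert p T) = count_first p T * count_ntl r M (S - T)"
      by (simp only: card_cartesian_product count_ntl_def count_first_def)
    moreover have "real (count_first p T) = sval (first_sfun p) T"
      using T fin assms by (intro count_first_eq) auto
    moreover have "real (count_ntl r M (S - T)) = sval (Cos {r..} * TS') (S - T)"
      using T assms by (intro count_ntl_eq) auto
    ultimately show "real (?c (insert p T)) = sval (first_sfun p) T * sval (Cos {r..} * TS') (S - T)"
      by simp
  qed
  also have "\<dots> = sval (first_sfun p * (Cos {r..} * TS')) S" by (simp only: sval_mult [of "first_sfun p"])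
  finally show ?thesis .
qed


text \<open>If \<open>p\<close> is the minimum, deleting it leaves a \<open>count_ntl\<close>.
  Otherwise the derivative of \<open>E' cos x cos z\<close> in a variable below \<open>p\<close> is
  \<open>(E cos x - sin x) E' cos z\<close>, whose first factor is \<open>first_sfun p\<close> by
  \<open>TS_Compl\<close>.\<close>

lemma count_joint_less:
  assumes "finite S" "\<forall>y\<in>S. 0 < y \<and> y < M" "0 < p" "p < r" "r < M" "p \<notin> S" "r \<notin> S"
  shows "real (count_joint p r M S) = sval (Cos {..<p} * Cos {r..} * TS') S"
proof (cases "\<forall>y\<in>S. p < y")
  case True
  have set: "insert M (insert r (insert p S)) = insert p (insert M (insert r S))" by auto
  have ntl: "next_to_last (p # w) = next_to_last w" if "w \<in> andre_words (insert M (insert r S))" for w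
    using that assms(5) next_to_last_append_long [of r w M "[]" p] by (auto simp: andre_words_iff)
  have "count_joint p r M S = card {w \<in> andre_words (insert M (insert r S)). next_to_last (p # w) = r}"
    unfolding count_joint_def set
    by (rule card_andre_words_hd_Min) (use assms True in auto)
  also have "\<dots> = count_ntl r M S"
    unfolding count_ntl_def by (simp add: ntl cong: conj_cong)
  also have "real \<dots> = sval (Cos {r..} * TS') S"
    using assms by (intro count_ntl_eq) auto
  also have "\<dots> = sval (Cos {..<p} * Cos {r..} * TS') S"
  proof -
    have "sagree (\<lambda>x. x) S (Cos {..<p} * Cos {r..} * TS') (1 * Cos {r..} * TS')"
      using True by (intro sagree_mult sagree_id_refl sagree_egf_disjoint) auto
    from sagreeD [OF this] show ?thesis by simp
  qed
  finally show ?thesis .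
next
  case False
  with assms obtain x S' where
    S: "S = insert x S'" "finite S'" "x \<notin> S'" "x < p" "\<forall>y\<in>S'. x < y"
    using obtain_Min_less [of S p] by metis
  have "real (count_joint p r M S) = sval (first_sfun p * (Cos {r..} * TS')) S'"
    unfolding S(1) by (rule count_joint_split) (use S assms in auto)
  also have "\<dots> = sval (Cos {..<p} * Cos {r..} * TS') S"
  proof -
    have "sderiv x (Cos {..<p} * Cos {r..} * TS')
        ((- Sin {..<p} * Cos {r..} + Cos {..<p} * 0) * TS' + Cos {..<p} * Cos {r..} * (TS * TS'))"
      using S assms by (intro sderiv_mult sderiv_TS' sderiv_Cos sderiv_egf_notin) auto
    moreover have "(- Sin {..<p} * Cos {r..} + Cos {..<p} * 0) * TS' + Cos {..<p} * Cos {r..} * (TS * TS')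
        = (TS * Cos {..<p} - Sin {..<p}) * (Cos {r..} * TS')"
      by (simp add: algebra_simps)
    moreover have "\<dots> = first_sfun p * (Cos {r..} * TS')"
      using TS_Compl [of "{..<p}"] by (simp add: Compl_lessThan)
    ultimately show ?thesis unfolding S(1) using sderivD S(2,3) by metis
  qed
  finally show ?thesis .
qed

text \<open>Rewrites the closed form of \<open>count_ntl\<close>, which uses the labels above a
  letter, in terms of the labels below it.\<close>

lemma Cos_Compl_mult_TS': "Cos (- X) * TS' = TS * Cos X + (TS' - 1) * Sin X"
proof -
  have "Cos (- X) * TS' = TS' * Cos UNIV * Cos X + TS' * Sin UNIV * Sin X"
    unfolding egf_cos_Compl by (simp add: algebra_simps)
  thus ?thesis by (simp only: TS_identities)
qed

text \<open>Here \<open>sin (x + z)\<close> is expanded, with \<open>x\<close> for the labels below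
  \<open>r\<close> and \<open>z\<close> for those above \<open>p\<close>; labels in between enter
  only through \<open>TS\<close> and \<open>TS'\<close>.\<close>

abbreviation greater_sfun :: "nat \<Rightarrow> nat \<Rightarrow> nat sfun" where
  "greater_sfun r p \<equiv> Cos {..<r} * Cos {p..} + TS * (Cos {p..} * Sin {..<r} + Sin {p..} * Cos {..<r})
    + (TS' - 1) * (Sin {..<r} * Sin {p..})"

text \<open>If \<open>r\<close> is the minimum, the word ends in \<open>r\<close>, \<open>M\<close>,
  and deleting both leaves a \<open>count_first\<close>. Otherwise the product from
  \<open>count_joint_split\<close> equals the derivative of the closed form once
  \<open>E * E\<close> is replaced by \<open>2 E' - 1\<close>.\<close>

lemma count_joint_greater:
  assumes "finite S" "\<forall>y\<in>S. 0 < y \<and> y < M" "0 < r" "r < p" "p < M" "p \<notin> S" "r \<notin> S"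
  shows "real (count_joint p r M S) = sval (greater_sfun r p) S"
proof (cases "\<forall>y\<in>S. r < y")
  case True
  have set: "insert M (insert r (insert p S)) = insert r (insert M (insert p S))" by auto
  have hd: "hd (w @ [r, M]) = hd w" if "w \<in> andre_words (insert p S)" for w
    using that by (cases w) (auto simp: andre_words_iff)
  have "count_joint p r M S = card {w \<in> andre_words (insert p S). hd (w @ [r, M]) = p}"
    unfolding count_joint_def set
    by (rule card_andre_words_next_to_last_Min) (use assms True in auto)
  also have "\<dots> = count_first p S"
    unfolding count_first_def by (simp add: hd cong: conj_cong)
  also have "real \<dots> = sval (first_sfun p) S"
    using assms by (intro count_first_eq) auto
  also have "\<dots> = sval (greater_sfun r p) S"
  proof -
    have "sagree (\<lambda>x. x) S (greater_sfun r p)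
        (1 * Cos {p..} + TS * (Cos {p..} * 0 + Sin {p..} * 1) + (TS' - 1) * (0 * Sin {p..}))"
      using True by (intro sagree_add sagree_mult sagree_id_refl sagree_egf_disjoint) auto
    from sagreeD [OF this] show ?thesis by simp
  qed
  finally show ?thesis .
next
  case False
  with assms obtain x S' where
    S: "S = insert x S'" "finite S'" "x \<notin> S'" "x < r" "\<forall>y\<in>S'. x < y"
    using obtain_Min_less [of S r] by metis
  have "real (count_joint p r M S) = sval (first_sfun p * (Cos {r..} * TS')) S'"
    unfolding S(1) by (rule count_joint_split) (use S assms in auto)
  also have "\<dots> = sval (greater_sfun r p) S"
  proof -
    let ?cx = "Cos {..<r}" and ?sx = "Sin {..<r}" and ?cz = "Cos {p..}" and ?sz = "Sin {p..}"
    \<comment> \<open>The derivative exactly as the rules produce it: the label \<open>x\<close>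
      lies below \<open>r\<close>, hence below \<open>p\<close>, and the factors on
      \<open>{p..}\<close> have derivative 0.\<close>
    let ?d = "(- ?sx * ?cz + ?cx * 0) +
      (TS' * (?cz * ?sx + ?sz * ?cx) + TS * ((0 * ?sx + ?cz * ?cx) + (0 * ?cx + ?sz * - ?sx))) +
      ((TS * TS' - 0) * (?sx * ?sz) + (TS' - 1) * (?cx * ?sz + ?sx * 0))"
    have d: "sderiv x (greater_sfun r p) ?d"
      using S assms
      by (intro sderiv_add sderiv_diff sderiv_mult sderiv_one sderiv_TS sderiv_TS' sderiv_Cos
          sderiv_Sin sderiv_egf_notin) auto
    have "first_sfun p * (Cos {r..} * TS') = first_sfun p * (TS * ?cx + (TS' - 1) * ?sx)"
      using Cos_Compl_mult_TS' [of "{..<r}"] by (simp add: Compl_lessThan)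
    also have "\<dots> = ?cz * (TS * ?cx + (TS' - 1) * ?sx) + ?sz * (TS * TS * ?cx + (TS * TS' - TS) * ?sx)"
      by (simp add: algebra_simps)
    also have "\<dots> = ?cz * (TS * ?cx + (TS' - 1) * ?sx) + ?sz * ((TS' + TS' - 1) * ?cx + (TS * TS' - TS) * ?sx)"
      by (simp only: TS_identities(5) mult_2)
    also have "\<dots> = ?d"
      by (simp add: algebra_simps)
    finally show ?thesis unfolding S(1) using sderivD [OF d S(2,3)] by simp
  qed
  finally show ?thesis .
qed

section \<open>Symmetry and the Entringer recurrence\<close>

text \<open>The reflection \<open>i -> n - i\<close> preserves \<open>{1..<n}\<close> and swaps the
  labels below the smaller mark with those above the larger one. Both closed forms are symmetric in
  these two groups.\<close>

lemma count_joint_symmetric: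
  assumes "0 < p" "p < n" "0 < r" "r < n" "p \<noteq> r"
  shows "count_joint p r n ({1..<n} - {p, r}) = count_joint (n - r) (n - p) n ({1..<n} - {n - r, n - p})"
proof -
  let ?S = "{1..<n} - {p, r}" and ?S' = "{1..<n} - {n - r, n - p}" and ?h = "\<lambda>i. n - i"
  have inj: "inj_on ?h ?S" by (auto simp: inj_on_def)
  have img: "?h ` ?S = ?S'"
  proof (intro set_eqI iffI)
    fix y
    assume "y \<in> ?S'"
    thus "y \<in> ?h ` ?S" using assms by (intro image_eqI [of _ _ "n - y"]) auto
  qed (use assms in auto)
  have egf: "sagree ?h ?S (egf A {..<n - i}) (egf A {i..})" "sagree ?h ?S (egf A {n - i..}) (egf A {..<i})"
    "sagree ?h ?S (egf A UNIV) (egf A UNIV)"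
    if "i = p \<or> i = r" for A i
    using that assms by (intro sagree_egf [OF inj]; auto)+
  show ?thesis
  proof (cases "p < r")
    case True
    have "sagree ?h ?S (Cos {..<n - r} * Cos {n - p..} * TS') (Cos {r..} * Cos {..<p} * TS')"
      by (intro sagree_mult egf) auto
    from sagreeD [OF this] have "sval (Cos {..<n - r} * Cos {n - p..} * TS') ?S' = sval (Cos {..<p} * Cos {r..} * TS') ?S"
      unfolding img by (simp add: mult.commute)
    moreover have "real (count_joint p r n ?S) = sval (Cos {..<p} * Cos {r..} * TS') ?S"
      using assms True by (intro count_joint_less) auto
    moreover have "real (count_joint (n - r) (n - p) n ?S') = sval (Cos {..<n - r} * Cos {n - p..} * TS') ?S'"
      using assms True by (intro count_joint_less) auto
    ultimately show ?thesis by simp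
  next
    case False
    have "sagree ?h ?S (greater_sfun (n - p) (n - r))
      (Cos {p..} * Cos {..<r} + TS * (Cos {..<r} * Sin {p..} + Sin {..<r} * Cos {p..})
        + (TS' - 1) * (Sin {p..} * Sin {..<r}))" (is "sagree _ _ _ ?g")
      by (intro sagree_add sagree_diff sagree_mult sagree_one egf inj) auto
    moreover have "?g = greater_sfun r p" by (simp add: algebra_simps)
    ultimately have "sval (greater_sfun (n - p) (n - r)) ?S' = sval (greater_sfun r p) ?S"
      using sagreeD [of ?h ?S "greater_sfun (n - p) (n - r)" ?g] by (simp only: img)
    moreover have "real (count_joint p r n ?S) = sval (greater_sfun r p) ?S"
      using assms False by (intro count_joint_greater) auto
    moreover have "real (count_joint (n - r) (n - p) n ?S') = sval (greater_sfun (n - p) (n - r)) ?S'"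
      using assms False by (intro count_joint_greater) auto
    ultimately show ?thesis by simp
  qed
qed

section \<open>The Entringer recurrence for the first letter\<close>

text \<open>Differentiating at \<open>m + 1\<close>, which is above \<open>m\<close>, respectively
  at \<open>m\<close>, which is below \<open>m + 1\<close>, brings the first two terms to
  \<open>?U\<close>. They differ by \<open>E cos z - sin z\<close>, which \<open>TS_Compl\<close>
  turns into \<open>cos x + E sin x\<close>; a relabelling matches this with the third term.\<close>

lemma first_sfun_entringer_rec:
  assumes "1 \<le> m" "m < n"
  shows "sval (first_sfun m) ({1..n} - {m}) =
    sval (first_sfun (m + 1)) ({1..n} - {m + 1}) + sval (first_sfun (n - m)) ({1..n - 1} - {n - m})"
proof -
  let ?U = "{1..n} - {m, m + 1}"
  \<comment> \<open>Reverses the order and narrows the gap at \<open>m\<close>, \<open>m + 1\<close>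
    to the single missing label \<open>n - m\<close>: labels below \<open>m\<close> land above
    \<open>n - m\<close>, the others below it.\<close>
  let ?h = "\<lambda>i. if i < m then n - i else n + 1 - i"
  have U: "finite ?U" "m \<notin> ?U" "m + 1 \<notin> ?U" by auto
  have ins: "{1..n} - {m} = insert (m + 1) ?U" "{1..n} - {m + 1} = insert m ?U" using assms by auto
  have "sderiv (m + 1) (first_sfun m) (- Sin {m..} + (TS' * Sin {m..} + TS * Cos {m..}))"
    by (intro sderiv_add sderiv_mult sderiv_TS sderiv_Cos sderiv_Sin) auto
  from sderivD [OF this U(1,3)] have
    1: "sval (first_sfun m) ({1..n} - {m}) = sval (TS * Cos {m..} - Sin {m..}) ?U + sval (TS' * Sin {m..}) ?U"
    unfolding ins by simp
  have "sderiv m (first_sfun (m + 1)) (0 + (TS' * Sin {m + 1..} + TS * 0))"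
    by (intro sderiv_add sderiv_mult sderiv_TS sderiv_egf_notin) auto
  from sderivD [OF this U(1,2)] have
    2: "sval (first_sfun (m + 1)) ({1..n} - {m + 1}) = sval (TS' * Sin {m + 1..}) ?U"
    unfolding ins by simp
  have "sagree (\<lambda>x. x) ?U (TS' * Sin {m + 1..}) (TS' * Sin {m..})"
    by (intro sagree_mult sagree_id_refl sagree_egf) auto
  from sagreeD [OF this] have 3: "sval (TS' * Sin {m + 1..}) ?U = sval (TS' * Sin {m..}) ?U" by simp
  have inj: "inj_on ?h ?U"
    using assms by (auto simp: inj_on_def split: if_splits)
  have img: "?h ` ?U = {1..n - 1} - {n - m}"
  proof (intro set_eqI iffI)
    fix y
    assume "y \<in> {1..n - 1} - {n - m}"
    thus "y \<in> ?h ` ?U"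
      using assms by (intro image_eqI [of _ _ "if y < n - m then n + 1 - y else n - y"]) auto
  qed (use assms in auto)
  have "sagree ?h ?U (first_sfun (n - m)) (Cos {..<m} + TS * Sin {..<m})"
    using assms by (intro sagree_add sagree_mult sagree_egf [OF inj]) auto
  from sagreeD [OF this] have "sval (first_sfun (n - m)) ({1..n - 1} - {n - m}) = sval (Cos {..<m} + TS * Sin {..<m}) ?U"
    unfolding img .
  also have "Cos {..<m} + TS * Sin {..<m} = TS * Cos {m..} - Sin {m..}"
    using TS_Compl [of "{m..}"] by (simp add: Compl_atLeast)
  finally show ?thesis using 1 2 3 by simp
qed

lemma count_first_entringer:
  assumes "1 \<le> m" "m \<le> n"
  shows "count_first m ({1..n} - {m}) = entringer n m"
  using assms
proof (induction n m rule: entringer.induct)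
  case (1 n m)
  have eq: "real (count_first k ({1..l} - {k})) = sval (first_sfun k) ({1..l} - {k})" if "1 \<le> k" for k l
    using that by (intro count_first_eq) auto
  consider (base) "n = 1" "m = 1" | (diag) "n \<ge> 2" "m = n" | (step) "m < n"
    using "1.prems" by linarith
  thus ?case
  proof cases
    case base
    have "{w. w = [Suc 0] \<and> hd w = Suc 0} = {[Suc 0]}" by auto
    thus ?thesis
      using base entringer_1_1 by (simp add: count_first_def andre_words_singleton)
  next
    case diag
    \<comment> \<open>No label exceeds \<open>n\<close>, so the closed form reduces to 1, which
      vanishes on the nonempty set \<open>{1..n} - {n}\<close>.\<close>
    have "sagree (\<lambda>x. x) ({1..n} - {n}) (first_sfun n) (1 + TS * 0)"
      by (intro sagree_add sagree_mult sagree_id_refl sagree_egf_disjoint) auto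
    from sagreeD [OF this] have "sval (first_sfun n) ({1..n} - {n}) = sval 1 ({1..n} - {n})"
      by simp
    moreover have "1 \<in> {1..n} - {n}" using diag by auto
    hence "{1..n} - {n} \<noteq> {}" by blast
    ultimately have "sval (first_sfun n) ({1..n} - {n}) = 0"
      by (simp only: sval_one if_False)
    hence "count_first n ({1..n} - {n}) = 0" using eq [of n n] diag by simp
    thus ?thesis using diag entringer_diag by simp
  next
    case step
    have "count_first (m + 1) ({1..n} - {m + 1}) = entringer n (m + 1)"
      using step "1.prems" by (intro "1.IH"(1)) auto
    moreover have "count_first (n - m) ({1..n - 1} - {n - m}) = entringer (n - 1) (n - m)"
      using step "1.prems" by (intro "1.IH"(2)) auto
    moreover have "real (count_first m ({1..n} - {m})) =
        real (count_first (m + 1) ({1..n} - {m + 1})) + real (count_first (n - m) ({1..n - 1} - {n - m}))"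
      using eq [of m n] eq [of "m + 1" n] eq [of "n - m" "n - 1"] step "1.prems"
        first_sfun_entringer_rec [of m n] by linarith
    ultimately show ?thesis using step "1.prems" by (simp add: entringer.simps [of n m])
  qed
qed

section \<open>Transfer to permutations of an interval\<close>

text \<open>The maximum stands right of each cut, so by induction it ends the right part.\<close>

lemma andre_I_last: "andre_I w \<Longrightarrow> w \<noteq> [] \<Longrightarrow> last w = Max (set w)"
proof (induction rule: andre_I.induct)
  case (split v v' x)
  have ne: "v' \<noteq> []" using split.hyps by auto
  have M: "Max (set (v @ v')) \<in> set v'" by fact
  hence "Max (set v') = Max (set (v @ v'))"
    by (intro Max_eqI) auto
  moreover have "Max (set (v @ x # v')) = Max (set (v @ v'))"
  proof (rule Max_eqI)
    fix y
    assume "y \<in> set (v @ x # v')"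
    moreover have "x \<le> Max (set (v @ v'))"
    proof -
      have "x \<le> Max (set (v @ v'))" if "x = Min (set (v @ x # v'))"
        using M by (subst that, intro Min_le) auto
      thus ?thesis using split.hyps by blast
    qed
    ultimately show "y \<le> Max (set (v @ v'))" by auto
  qed (use M in auto)
  ultimately show ?case using split.IH(2) ne by simp
qed auto


text \<open>The letter \<open>n\<close> is last, hence neither first nor next to last. These two
  positions differ for \<open>n > 2\<close> and coincide for \<open>n = 2\<close>.\<close>

lemma And_I_bounds:
  assumes "w \<in> And_I n" "n \<ge> 2"
  shows "0 < hd w" "hd w < n" "0 < next_to_last w" "next_to_last w < n" "n > 2 \<Longrightarrow> hd w \<noteq> next_to_last w"
proof -
  have w: "distinct w" "set w = {1..n}" "andre_I w"
    using assms(1) by (auto simp: And_I_eq andre_words_iff)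
  have len: "length w = n" using distinct_card [OF w(1)] w(2) by simp
  hence ne: "w \<noteq> []" using assms(2) by auto
  have hd: "hd w = w ! 0" using ne by (rule hd_conv_nth)
  have "last w = n"
    using andre_I_last [OF w(3) ne] w(2) assms(2) by (simp add: Max_eq_iff)
  hence last: "w ! (n - 1) = n" using ne len by (simp add: last_conv_nth)
  have in_set: "w ! i \<in> {1..n}" if "i < n" for i
    using that nth_mem [of i w] w(2) len by simp
  have diff: "w ! i \<noteq> w ! j" if "i < n" "j < n" "i \<noteq> j" for i j
    using that w(1) len by (simp add: nth_eq_iff_index_eq)
  have "hd w \<noteq> n" "next_to_last w \<noteq> n"
    using diff [of 0 "n - 1"] diff [of "n - 2" "n - 1"] last len assms(2)
    by (auto simp: hd next_to_last_def)
  moreover have "hd w \<in> {1..n}" "next_to_last w \<in> {1..n}"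
    using in_set [of 0] in_set [of "n - 2"] len assms(2) by (auto simp: hd next_to_last_def)
  ultimately show "0 < hd w" "hd w < n" "0 < next_to_last w" "next_to_last w < n" by auto
  show "hd w \<noteq> next_to_last w" if "n > 2"
    using diff [of 0 "n - 2"] len that by (simp add: hd next_to_last_def)
qed

lemma card_And_I_joint_symmetric:
  assumes n: "n \<ge> 2" and pr: "0 < p" "p < n" "0 < r" "r < n"
  shows "card {w \<in> And_I n. hd w = p \<and> next_to_last w = r} =
    card {w \<in> And_I n. hd w = n - r \<and> next_to_last w = n - p}"
proof (cases "p = r")
  \<comment> \<open>One letter can be both first and next to last only for \<open>n = 2\<close>,
    where \<open>p = r = 1\<close> is fixed by the reflection.\<close>
  case True
  show ?thesis
  proof (cases "n = 2")
    case True
    hence "n - p = p" "n - r = r" using pr by auto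
    thus ?thesis using \<open>p = r\<close> by simp
  next
    case False
    hence "{w \<in> And_I n. hd w = k \<and> next_to_last w = k} = {}" for k
      using And_I_bounds(5) [OF _ n] n by fastforce
    thus ?thesis unfolding \<open>p = r\<close> by (simp only:)
  qed
next
  case False
  have joint: "card {w \<in> And_I n. hd w = p \<and> next_to_last w = r} = count_joint p r n ({1..<n} - {p, r})"
    if "0 < p" "p < n" "0 < r" "r < n" for p r
  proof -
    have "insert n (insert r (insert p ({1..<n} - {p, r}))) = {1..n}" using that by auto
    thus ?thesis by (simp add: count_joint_def And_I_eq)
  qed
  have "{1..<n} - {n - p, n - r} = {1..<n} - {n - r, n - p}" by auto
  thus ?thesis
    using joint [of p r] joint [of "n - r" "n - p"] pr False count_joint_symmetric [of p n r] by simp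
qed

theorem theorem2p4:
  fixes n :: nat
  assumes "n \<ge> 2"
  shows
    "(\<forall>m\<in>{1..n}.
        card {w \<in> And_I n. first_letter w = m} = entringer n m \<and>
        card {w \<in> And_I n. int n - int (next_to_last w) = int m} = entringer n m) \<and>
     real (card (And_I n)) = euler_number n \<and>
     (\<forall>p q :: int.
        card {w \<in> And_I n. int (first_letter w) = p \<and> int n - int (next_to_last w) = q} =
        card {w \<in> And_I n. int (first_letter w) = q \<and> int n - int (next_to_last w) = p})"
proof -
  define A where "A = And_I n"
  define f g where "f = (\<lambda>w. int (first_letter w))" and "g = (\<lambda>w. int n - int (next_to_last w))"
  have fin: "finite A" by (simp add: A_def And_I_eq)
  have bounds: "f w \<in> {1..int n - 1}" "g w \<in> {1..int n - 1}" if "w \<in> A" for w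
    using And_I_bounds [of w n] that assms by (auto simp: A_def f_def g_def first_letter_def)
  \<comment> \<open>For next-to-last letter \<open>r\<close> and \<open>q = n - r\<close>, the
    reflected pair \<open>(n - r, n - p)\<close> of first and next-to-last letters has statistics
    \<open>(q, p)\<close>. Outside the range of both statistics the sets are empty.\<close>
  have sym: "card {w \<in> A. f w = p \<and> g w = q} = card {w \<in> A. f w = q \<and> g w = p}" for p q
  proof (cases "p \<in> {1..int n - 1} \<and> q \<in> {1..int n - 1}")
    case True
    define p' q' where "p' = nat p" and "q' = nat q"
    have pq: "p = int p'" "q = int q'" "0 < p'" "p' < n" "0 < q'" "q' < n"
      using True by (auto simp: p'_def q'_def)
    have eq: "{w \<in> A. f w = int i \<and> g w = int j} = {w \<in> And_I n. hd w = i \<and> next_to_last w = n - j}"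
      if "j < n" for i j
      using that by (auto simp: A_def f_def g_def first_letter_def)
    have "card {w \<in> And_I n. hd w = p' \<and> next_to_last w = n - q'} =
        card {w \<in> And_I n. hd w = n - (n - q') \<and> next_to_last w = n - p'}"
      using pq assms by (intro card_And_I_joint_symmetric) auto
    thus ?thesis using pq(4,6) unfolding pq(1,2) by (simp add: eq)
  next
    case False
    hence "{w \<in> A. f w = p \<and> g w = q} = {}" "{w \<in> A. f w = q \<and> g w = p} = {}"
      using bounds by blast+
    thus ?thesis by (simp only:)
  qed
  have first: "card {w \<in> A. f w = int m} = entringer n m" if "m \<in> {1..n}" for m
  proof -
    have "insert m ({1..n} - {m}) = {1..n}" using that by auto
    thus ?thesis using count_first_entringer [of m n] that
      by (simp add: count_first_def A_def f_def first_letter_def And_I_eq)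
  qed
  have marginal: "card {w \<in> A. h w = m} = (\<Sum>k\<in>{1..int n - 1}. card {w \<in> A. h w = m \<and> k' w = k})"
    if "\<And>w. w \<in> A \<Longrightarrow> k' w \<in> {1..int n - 1}" for h k' :: "nat list \<Rightarrow> int" and m
  proof -
    have "{w \<in> A. h w = m} = (\<Union>k\<in>{1..int n - 1}. {w \<in> A. h w = m \<and> k' w = k})"
      using that by blast
    thus ?thesis using fin by (simp only:) (intro card_UN_disjoint, auto)
  qed
  \<comment> \<open>Equality of the two marginals follows by summing the symmetric joint
    distribution over one statistic.\<close>
  have fg: "card {w \<in> A. g w = int m} = card {w \<in> A. f w = int m}" for m
  proof -
    have "card {w \<in> A. g w = int m} = (\<Sum>k\<in>{1..int n - 1}. card {w \<in> A. g w = int m \<and> f w = k})"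
      by (rule marginal [OF bounds(1)])
    also have "\<dots> = (\<Sum>k\<in>{1..int n - 1}. card {w \<in> A. f w = int m \<and> g w = k})"
    proof (intro sum.cong refl)
      fix k
      have "{w \<in> A. g w = int m \<and> f w = k} = {w \<in> A. f w = k \<and> g w = int m}" by auto
      thus "card {w \<in> A. g w = int m \<and> f w = k} = card {w \<in> A. f w = int m \<and> g w = k}"
        using sym [of k "int m"] by (simp only:)
    qed
    also have "\<dots> = card {w \<in> A. f w = int m}"
      by (rule marginal [OF bounds(2), symmetric])
    finally show ?thesis .
  qed
  have euler: "real (card A) = euler_number n"
    using card_andre_words [of "{1..n}"]
    by (simp add: A_def And_I_eq sval_egf euler_number_def fps_tan_sec_def)
  have first': "card {w \<in> A. first_letter w = m} = entringer n m" if "m \<in> {1..n}" for m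
    using first [OF that] by (simp add: f_def)
  have "(\<forall>m\<in>{1..n}. card {w \<in> A. first_letter w = m} = entringer n m \<and>
        card {w \<in> A. g w = int m} = entringer n m) \<and> real (card A) = euler_number n \<and>
      (\<forall>p q. card {w \<in> A. f w = p \<and> g w = q} = card {w \<in> A. f w = q \<and> g w = p})"
    using first' first euler by (intro conjI ballI allI sym) (simp_all only: fg)
  thus ?thesis unfolding A_def f_def g_def .
qed

end
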